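(* The minimal area of a Voronoi cell $V(\mathbf{x})$, taken over all admissible collections of occupied points in $\mathbb{R}^2$ and all occupied points $\mathbf{x}$ in them, is equal to $2\sqrt{3}$. The minimum is achieved only on occupied points $\mathbf{x}$ whose Voronoi cell $V(\mathbf{x})$ is a perfect (i.e. regular) hexagon with side length $2/\sqrt{3}$, or equivalently, whose polygon of neighbors is a perfect (regular) hexagon with side length $2$.
   Context: For $\mathbf{x}\in\mathbb{R}^2$ and $r>0$, $B_r(\mathbf{x})$ is the open disk of radius $r$ centered at $\mathbf{x}$, and $B(\mathbf{x})=B_1(\mathbf{x})$. A collection $\{\mathbf{x}_i\}$ of points of $\mathbb{R}^2$ (necessarily finite or countable) is called admissible if the open unit disks $B(\mathbf{x}_i)$ are non-overlapping, i.e. $|\mathbf{x}_{i'}-\mathbf{x}_{i''}|\ge 2$ (Euclidean distance) for any two distinct points of the collection. The points of the collection are called occupied points. For an occupied point $\mathbf{x}_{i'}$ of an admissible collection $\{\mathbf{x}_i\}$, its Voronoi cell is $$V(\mathbf{x}_{i'})=\left\{\mathbf{z}\in\mathbb{R}^2:\ |\mathbf{x}_{i'}-\mathbf{z}|\le \inf_{i''\ne i'}|\mathbf{x}_{i''}-\mathbf{z}|\right\}.$$ Another occupied point $\mathbf{x}_{i''}\neq\mathbf{x}_{i'}$ is called a neighboring occupied point (neighbor) of $\mathbf{x}_{i'}$ if $V(\mathbf{x}_{i'})\cap V(\mathbf{x}_{i''})$ contains more than one point. If $V(\mathbf{x})$ is bounded, it is a convex polygon, and each of its sides is the common side of $V(\mathbf{x})$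 and $V(\mathbf{y})$ for exactly one neighbor $\mathbf{y}$ of $\mathbf{x}$ (which is the reflection of $\mathbf{x}$ in that side). The clockwise circular order of the sides of $V(\mathbf{x})$ gives a clockwise circular order of the neighbors of $\mathbf{x}$; connecting the neighbors by segments in this circular order gives the polygon of neighbors of $\mathbf{x}$. *)

theory Defs
  imports "HOL-Analysis.Analysis"
begin

definition admissible :: "(real^2) set \<Rightarrow> bool" where
  "admissible X \<longleftrightarrow> pairwise (\<lambda>p q. 2 \<le> dist p q) X"

text \<open>The infimum is taken in the extended reals, so that the cell of the only point of a
  one-point collection is the whole plane.\<close>

definition voronoi_cell :: "(real^2) set \<Rightarrow> real^2 \<Rightarrow> (real^2) set" where
  "voronoi_cell X x = {z. ereal (dist x z) \<le> (INF y\<in>X - {x}. ereal (dist y z))}"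

definition neighbor :: "(real^2) set \<Rightarrow> real^2 \<Rightarrow> real^2 \<Rightarrow> bool" where
  "neighbor X x y \<longleftrightarrow> y \<in> X \<and> y \<noteq> x \<and>
     (\<exists>p q. p \<noteq> q \<and> p \<in> voronoi_cell X x \<inter> voronoi_cell X y
                 \<and> q \<in> voronoi_cell X x \<inter> voronoi_cell X y)"

definition cross2 :: "real^2 \<Rightarrow> real^2 \<Rightarrow> real" where
  "cross2 u v = u $ 1 * v $ 2 - u $ 2 * v $ 1"

text \<open>Polygons are given by the list of their vertices in circular order; indices are read
  modulo the length. A list traverses the boundary of a (strictly) convex polygon once,
  clockwise, iff every directed side has all vertices other than its two endpoints strictly on its
  right.\<close>

abbreviation cnth :: "'a list \<Rightarrow> nat \<Rightarrow> 'a" where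
  "cnth ps i \<equiv> ps ! (i mod length ps)"

definition clockwise_convex_polygon :: "(real^2) list \<Rightarrow> bool" where
  "clockwise_convex_polygon ps \<longleftrightarrow> 3 \<le> length ps \<and>
     (\<forall>i<length ps. \<forall>j<length ps. j \<noteq> i \<and> j \<noteq> Suc i mod length ps \<longrightarrow>
        cross2 (cnth ps (Suc i) - ps ! i) (ps ! j - ps ! i) < 0)"

definition convex_polygon :: "(real^2) list \<Rightarrow> bool" where
  "convex_polygon ps \<longleftrightarrow> clockwise_convex_polygon ps \<or> clockwise_convex_polygon (rev ps)"

text \<open>The angle at \<open>b\<close> between the segments from \<open>b\<close> to \<open>a\<close> and from \<open>b\<close> to \<open>c\<close>, in
  \<open>[0, \<pi>]\<close>; for consecutive vertices of a convex polygon it is the interior angle.\<close>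

definition vertex_angle :: "real^2 \<Rightarrow> real^2 \<Rightarrow> real^2 \<Rightarrow> real" where
  "vertex_angle a b c = arccos (((a - b) \<bullet> (c - b)) / (norm (a - b) * norm (c - b)))"

definition regular_polygon :: "nat \<Rightarrow> real \<Rightarrow> (real^2) list \<Rightarrow> bool" where
  "regular_polygon n s ps \<longleftrightarrow> length ps = n \<and> convex_polygon ps \<and>
     (\<forall>i<n. dist (ps ! i) (cnth ps (i + 1)) = s) \<and>
     (\<exists>\<alpha>. \<forall>i<n. vertex_angle (ps ! i) (cnth ps (i + 1)) (cnth ps (i + 2)) = \<alpha>)"

text \<open>The closed polygonal region bounded by a regular hexagon with side length \<open>s\<close>.\<close>

definition regular_hexagon_region :: "real \<Rightarrow> (real^2) set \<Rightarrow> bool" where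
  "regular_hexagon_region s P \<longleftrightarrow> (\<exists>ps. regular_polygon 6 s ps \<and> P = convex hull (set ps))"

text \<open>\<open>neighbor_polygon X x ns\<close>: the cell of \<open>x\<close> is bounded, hence a convex polygon, and \<open>ns\<close> lists
  the neighbors of \<open>x\<close> in the clockwise circular order of the sides of the cell (so \<open>ns\<close> is
  determined up to rotation). The \<open>i\<close>-th side is common to the cells of \<open>x\<close> and of \<open>ns ! i\<close>.\<close>

definition neighbor_polygon :: "(real^2) set \<Rightarrow> real^2 \<Rightarrow> (real^2) list \<Rightarrow> bool" where
  "neighbor_polygon X x ns \<longleftrightarrow> set ns = {y. neighbor X x y} \<and>
     (\<exists>vs. clockwise_convex_polygon vs \<and> voronoi_cell X x = convex hull (set vs) \<and>
        length ns = length vs \<and>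
        (\<forall>i<length vs. voronoi_cell X x \<inter> voronoi_cell X (ns ! i)
                         = closed_segment (vs ! i) (cnth vs (Suc i))))"

end

theory Submission imports Defs begin

text \<open>Let \<open>r = 2 / sqrt 3\<close>. If \<open>a, b, c\<close> are vectors of length at most \<open>r\<close> with mutual distances at
  least \<open>2\<close>, then all these inequalities are equalities and \<open>a + b + c = 0\<close>, because
  \<open>\<bar>a - b\<bar>\<^sup>2 + \<bar>b - c\<bar>\<^sup>2 + \<bar>c - a\<bar>\<^sup>2 = 3 (\<bar>a\<bar>\<^sup>2 + \<bar>b\<bar>\<^sup>2 + \<bar>c\<bar>\<^sup>2) - \<bar>a + b + c\<bar>\<^sup>2\<close>. Hence the sectors of the disk of
  radius \<open>r\<close> about \<open>x\<close> that belong to the caps cut off by the bisectors are disjoint. In every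
  sector the triangle left by its cap occupies at least the proportion which it occupies for
  distance \<open>2\<close>, where six sectors fit into the disk; so the cell contains at least this proportion
  of the disk, which is \<open>2 sqrt 3\<close>. In the case of equality the closed sectors cover the disk. The
  end of the arc of a sector then lies in another closed sector, and the equality case above shows
  that both neighbors have distance \<open>2\<close> and differ by a rotation by 60 degrees.\<close>

subsection \<open>Hexagons in terms of the rotation by 60 degrees\<close>

text \<open>Working inside one disk spares any discussion of the shape of the cell: only finitely
  many bisectors meet the disk, and a bound for the part inside it also covers cells of infinite
  area. No area of a disk or of a circular sector is evaluated. Let q be the area of the model
  sector for distance 2 and t that of its triangle. Six sectors give the disk at least the area 6 q
  / sqrt 3, and the proportion t / q turns this into 6 t / sqrt 3; q cancels and t >= 1 remains.
  Since t < q, area of the disk outside all sectors, which counts in full, improves the bound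
  strictly; this is why equality forces a cover. The equivalence of the two hexagon conditions is
  independent of areas. Its obstacle is that neither condition says where \<open>x\<close> lies: the
  center of the cell, or of the polygon of neighbors, has to be identified with \<open>x\<close>
  first. As regularity is given by sides and angles, it is translated into vertices
  \<open>c + rot60^i u\<close> beforehand.\<close>

lemma inner_2: "(u::real^2) \<bullet> v = u$1 * v$1 + u$2 * v$2"
  by (simp add: inner_vec_def sum_2)

lemma vec_eq_2: "(u::real^2) = v \<longleftrightarrow> u$1 = v$1 \<and> u$2 = v$2"
  by (simp add: vec_eq_iff forall_2)

definition rot60 :: "real^2 \<Rightarrow> real^2" where
  "rot60 u = vector [u$1 / 2 + sqrt 3 / 2 * u$2, u$2 / 2 - sqrt 3 / 2 * u$1]"

lemma rot60_nth [simp]: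
  "rot60 u $ 1 = u$1 / 2 + sqrt 3 / 2 * u$2" "rot60 u $ 2 = u$2 / 2 - sqrt 3 / 2 * u$1"
  by (simp_all add: rot60_def)

lemma sqrt3_mult: "sqrt 3 * (sqrt 3 * x) = 3 * x"
  by (simp flip: mult.assoc)

text \<open>The minimal polynomial of a primitive sixth root of unity; it reduces every power of the
  rotation to a combination of \<open>u\<close> and \<open>rot60 u\<close>.\<close>

lemma rot60_rot60: "rot60 (rot60 u) = rot60 u - u"
  by (simp add: vec_eq_2 field_simps sqrt3_mult)

lemma rot60_minus: "rot60 (- u) = - rot60 u"
  and rot60_diff: "rot60 (u - v) = rot60 u - rot60 v"
  by (simp_all add: vec_eq_2 field_simps)

lemma inner_rot60 [simp]:
  "u \<bullet> rot60 u = (u \<bullet> u) / 2" "rot60 u \<bullet> u = (u \<bullet> u) / 2"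
  "rot60 u \<bullet> rot60 u = u \<bullet> u"
  by (simp_all add: inner_2 field_simps sqrt3_mult)

lemma cross2_rot60: "cross2 u (rot60 u) = - (sqrt 3 / 2) * (u \<bullet> u)"
  by (simp add: inner_2 cross2_def field_simps)

text \<open>Cramer's rule, cleared of the denominator.\<close>

lemma cross2_expansion:
  "cross2 u v *\<^sub>R z = cross2 z v *\<^sub>R u + cross2 u z *\<^sub>R v"
  by (simp add: vec_eq_2 cross2_def algebra_simps)

lemma rot60_basis:
  assumes "u \<noteq> 0"
  obtains a b where "z = a *\<^sub>R u + b *\<^sub>R rot60 u"
proof -
  define k where "k = cross2 u (rot60 u)"
  have "k \<noteq> 0" using assms by (simp add: k_def cross2_rot60)
  then have "z = (1 / k) *\<^sub>R (k *\<^sub>R z)" by simp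
  also have "\<dots> = (cross2 z (rot60 u) / k) *\<^sub>R u + (cross2 u z / k) *\<^sub>R rot60 u"
    unfolding k_def cross2_expansion[of u "rot60 u" z] by (simp add: scaleR_add_right)
  finally show ?thesis by (rule that)
qed

text \<open>Listed clockwise: \<open>c + rot60^i u\<close> for \<open>i < 6\<close>.\<close>

definition hexagon :: "real^2 \<Rightarrow> real^2 \<Rightarrow> (real^2) list" where
  "hexagon c u = [c + u, c + rot60 u, c + (rot60 u - u), c - u, c - rot60 u, c + (u - rot60 u)]"

lemma set_hexagon_rot60: "set (hexagon c (rot60 u)) = set (hexagon c u)"
  by (auto simp: hexagon_def rot60_rot60 algebra_simps)

lemma length_hexagon [simp]: "length (hexagon c u) = 6"
  by (simp add: hexagon_def)

lemma less_6: "i < (6::nat) \<longleftrightarrow> i = 0 \<or> i = 1 \<or> i = 2 \<or> i = 3 \<or> i = 4 \<or> i = 5"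
  by auto

lemma all_less_6: "(\<forall>i<(6::nat). P i) \<longleftrightarrow> P 0 \<and> P 1 \<and> P 2 \<and> P 3 \<and> P 4 \<and> P 5"
  unfolding less_6 by blast

section \<open>Powers of the rotation and the six cones between them\<close>

lemma funpow_rot60:
  "(rot60 ^^ 2) u = rot60 u - u" "(rot60 ^^ 3) u = - u" "(rot60 ^^ 4) u = - rot60 u"
  "(rot60 ^^ 5) u = u - rot60 u" "(rot60 ^^ 6) u = u"
  by (simp_all add: eval_nat_numeral rot60_rot60 rot60_diff rot60_minus)

lemma hexagon_nth: "i < 6 \<Longrightarrow> hexagon c u ! i = c + (rot60 ^^ i) u"
  unfolding less_6 by (auto simp: hexagon_def funpow_rot60)

lemma hexagon_cnth_Suc: "i < 6 \<Longrightarrow> cnth (hexagon c u) (Suc i) = c + (rot60 ^^ Suc i) u"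
  by (cases "Suc i = 6") (simp_all add: hexagon_nth funpow_rot60 del: funpow.simps)

lemma set_hexagon: "set (hexagon c u) = {c + (rot60 ^^ i) u | i. i < 6}"
  unfolding set_conv_nth length_hexagon by (metis hexagon_nth)

lemma set_hexagon_funpow [simp]: "set (hexagon c ((rot60 ^^ k) u)) = set (hexagon c u)"
  by (induction k) (simp_all add: set_hexagon_rot60)

lemma in_set_hexagon: "c + u \<in> set (hexagon c u)" "c + rot60 u \<in> set (hexagon c u)"
  by (simp_all add: hexagon_def)

lemma funpow_rot60_in_hexagon: "c + (rot60 ^^ k) u \<in> set (hexagon c u)"
  by (metis set_hexagon_funpow in_set_hexagon(1))

lemma inner_funpow_rot60 [simp]: "(rot60 ^^ k) u \<bullet> (rot60 ^^ k) u = u \<bullet> u"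
  by (induction k) simp_all

lemma rot60_add: "rot60 (u + v) = rot60 u + rot60 v"
  by (simp add: vec_eq_2 field_simps)

lemma funpow_rot60_add: "(rot60 ^^ k) (u + v) = (rot60 ^^ k) u + (rot60 ^^ k) v"
  by (induction k) (simp_all add: rot60_add)

text \<open>In coordinates with respect to \<open>u\<close> and \<open>rot60 u\<close>, the lines a
  = 0, b = 0 and a + b = 0 cut the plane into the six cones between consecutive rotated vectors; the
  case distinction runs through them.\<close>

lemma hexagon_sector:
  assumes "u \<noteq> 0"
  obtains k a b where "k < 6" "0 \<le> a" "0 \<le> b"
    "z = a *\<^sub>R (rot60 ^^ k) u + b *\<^sub>R rot60 ((rot60 ^^ k) u)"
proof -
  obtain a b where z: "z = a *\<^sub>R u + b *\<^sub>R rot60 u" using rot60_basis[OF assms] by metis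
  consider "0 \<le> a" "0 \<le> b" | "a \<le> 0" "0 \<le> a + b" | "0 \<le> b" "a + b \<le> 0"
    | "a \<le> 0" "b \<le> 0" | "0 \<le> a" "a + b \<le> 0" | "b \<le> 0" "0 \<le> a + b" by linarith
  then show thesis
  proof cases
    case 1
    then show thesis
      by (intro that[of 0 "a" "b"])
        (simp_all add: z funpow_rot60 rot60_rot60 rot60_diff rot60_minus algebra_simps)
  next
    case 2
    then show thesis
      by (intro that[of 1 "a + b" "- a"])
        (simp_all add: z funpow_rot60 rot60_rot60 rot60_diff rot60_minus algebra_simps)
  next
    case 3
    then show thesis
      by (intro that[of 2 "b" "- (a + b)"])
        (simp_all add: z funpow_rot60 rot60_rot60 rot60_diff rot60_minus algebra_simps)
  next
    case 4
    then show thesis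
      by (intro that[of 3 "- a" "- b"])
        (simp_all add: z funpow_rot60 rot60_rot60 rot60_diff rot60_minus algebra_simps)
  next
    case 5
    then show thesis
      by (intro that[of 4 "- (a + b)" "a"])
        (simp_all add: z funpow_rot60 rot60_rot60 rot60_diff rot60_minus algebra_simps)
  next
    case 6
    then show thesis
      by (intro that[of 5 "- b" "a + b"])
        (simp_all add: z funpow_rot60 rot60_rot60 rot60_diff rot60_minus algebra_simps)
  qed
qed

lemma clockwise_hexagon:
  assumes "u \<noteq> 0"
  shows "clockwise_convex_polygon (hexagon c u)"
proof -
  have "0 < u \<bullet> u" using assms by simp
  then have s: "0 < sqrt 3 * (u \<bullet> u)" "0 < (u \<bullet> u) * sqrt 3" by simp_all
  have k: "cross2 u (rot60 u) = - (sqrt 3 * (u \<bullet> u)) / 2" by (simp add: cross2_rot60)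
  have bil: "cross2 (a - b) d = cross2 a d - cross2 b d" "cross2 d (a - b) = cross2 d a - cross2 d b"
     "cross2 (- a) d = - cross2 a d" "cross2 d (- a) = - cross2 d a"
     "cross2 (a + b) d = cross2 a d + cross2 b d" "cross2 d (a + b) = cross2 d a + cross2 d b"
     "cross2 a a = 0" "cross2 (2 * a) d = 2 * cross2 a d" "cross2 d (2 * a) = 2 * cross2 d a" for a b d
    by (simp_all add: cross2_def algebra_simps)
  have k': "cross2 (rot60 u) u = (sqrt 3 * (u \<bullet> u)) / 2"
    using k unfolding cross2_def by argo
  show ?thesis
    unfolding clockwise_convex_polygon_def length_hexagon all_less_6
    using s by (simp add: hexagon_def bil k k')
qed

lemma regular_hexagon:
  assumes "norm u = s" "0 < s"
  shows "regular_polygon 6 s (hexagon c u)"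
proof -
  have u: "u \<noteq> 0" using assms by auto
  have nR: "norm (rot60 u) = norm u" by (simp add: norm_eq_sqrt_inner)
  have nRu: "norm (rot60 u - u) = norm u" "norm (u - rot60 u) = norm u"
    by (simp_all add: norm_eq_sqrt_inner inner_simps)
  have sides: "\<forall>i<6. dist (hexagon c u ! i) (cnth (hexagon c u) (i + 1)) = s"
    unfolding all_less_6
    by (simp add: hexagon_def dist_norm nR nRu assms)
  have "\<forall>i<6. vertex_angle (hexagon c u ! i) (cnth (hexagon c u) (i + 1)) (cnth (hexagon c u) (i + 2))
      = arccos (- 1 / 2)"
    unfolding all_less_6 using u
    by (simp add: hexagon_def vertex_angle_def nR nRu inner_simps power2_norm_eq_inner flip: power2_eq_square)
  then show ?thesis
    using sides clockwise_hexagon[OF u] unfolding regular_polygon_def convex_polygon_def by (metis length_hexagon)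
qed

subsection \<open>Regular hexagons as equilateral and equiangular polygons\<close>

lemma cos_vertex_angle:
  "cos (vertex_angle a b c) = ((a - b) \<bullet> (c - b)) / (norm (a - b) * norm (c - b))"
proof -
  have "\<bar>((a - b) \<bullet> (c - b)) / (norm (a - b) * norm (c - b))\<bar> \<le> 1"
    using Cauchy_Schwarz_ineq2[of "a - b" "c - b"]
    by (auto simp: abs_mult divide_le_eq_1)
  then show ?thesis unfolding vertex_angle_def by (rule cos_arccos_abs)
qed

lemma vertex_angle_commute: "vertex_angle a b c = vertex_angle c b a"
  by (simp add: vertex_angle_def inner_commute mult.commute)

text \<open>Consecutive edges of equal length satisfy \<open>e'' = c e' - e\<close>, where \<open>c\<close> is twice the cosine
  of the turning angle.\<close>

lemma edge_recursion:
  fixes e e' e'' :: "real^2"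
  assumes n: "e \<bullet> e = S" "e' \<bullet> e' = S" "e'' \<bullet> e'' = S" and i: "e \<bullet> e' = k" "e' \<bullet> e'' = k"
    and c: "cross2 e e' < 0" "cross2 e' e'' < 0"
  shows "S *\<^sub>R e'' = (2 * k) *\<^sub>R e' - S *\<^sub>R e"
proof -
  have lagrange: "(cross2 u v)\<^sup>2 = (u \<bullet> u) * (v \<bullet> v) - (u \<bullet> v)\<^sup>2" for u v :: "real^2"
    by (simp add: cross2_def inner_2 power2_eq_square algebra_simps)
  \<comment> \<open>By Lagrange's identity, lengths and inner products determine the cross product
    up to sign; the orientation then fixes the sign.\<close>
  have "(cross2 e e')\<^sup>2 = (cross2 e' e'')\<^sup>2" by (simp add: lagrange n i)
  then have *: "cross2 e e' = cross2 e' e''"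
    using c by (auto simp: power2_eq_iff)
  have e1: "(e \<bullet> e') *\<^sub>R e' = (e' \<bullet> e') *\<^sub>R e - vector [cross2 e e' * e'$2, - cross2 e e' * e'$1]"
    by (simp add: vec_eq_2 inner_2 cross2_def algebra_simps)
  have e2: "(e' \<bullet> e'') *\<^sub>R e' = (e' \<bullet> e') *\<^sub>R e'' + vector [cross2 e' e'' * e'$2, - cross2 e' e'' * e'$1]"
    by (simp add: vec_eq_2 inner_2 cross2_def algebra_simps)
  have "(2 * k) *\<^sub>R e' = k *\<^sub>R e' + k *\<^sub>R e'"
    by (simp flip: scaleR_left_distrib)
  also have "\<dots> = S *\<^sub>R e + S *\<^sub>R e''"
    using arg_cong2[OF e1 e2, of "(+)"] unfolding * n i by (simp only: diff_add_eq add_diff_cancel_right' flip: add.assoc)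
  finally have "(2 * k) *\<^sub>R e' = S *\<^sub>R e + S *\<^sub>R e''" .
  then show ?thesis by simp
qed

text \<open>The recursion expresses all edges by the first two, and closing up forces (1 + c)^2 (1 -
  c) = 0. For c = -1 the path is an equilateral triangle traversed twice, which strict convexity
  excludes; c = 1 is a turn by 60 degrees at each vertex.\<close>

lemma clockwise_equilateral_equiangular_hexagon:
  assumes cw: "clockwise_convex_polygon [p0, p1, p2, p3, p4, p5]"
    and s: "dist p0 p1 = s" "dist p1 p2 = s" "dist p2 p3 = s" "dist p3 p4 = s" "dist p4 p5 = s"
      "dist p5 p0 = s"
    and a: "vertex_angle p0 p1 p2 = \<alpha>" "vertex_angle p1 p2 p3 = \<alpha>" "vertex_angle p2 p3 p4 = \<alpha>"
      "vertex_angle p3 p4 p5 = \<alpha>" "vertex_angle p4 p5 p0 = \<alpha>"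
    and pos: "0 < s"
  shows "\<exists>c u. norm u = s \<and> [p0, p1, p2, p3, p4, p5] = hexagon c u"
proof -
  define e0 e1 e2 e3 e4 e5 where e: "e0 = p1 - p0" "e1 = p2 - p1" "e2 = p3 - p2" "e3 = p4 - p3"
    "e4 = p5 - p4" "e5 = p0 - p5"
  define S where "S = s\<^sup>2"
  have S: "0 < S" using pos by (simp add: S_def)
  define c where "c = - 2 * cos \<alpha>"
  have six: "length [p0, p1, p2, p3, p4, p5] = 6" by simp
  have left: "cross2 (p1 - p0) (p2 - p0) < 0" "cross2 (p2 - p1) (p3 - p1) < 0"
    "cross2 (p3 - p2) (p4 - p2) < 0" "cross2 (p4 - p3) (p5 - p3) < 0" "cross2 (p5 - p4) (p0 - p4) < 0"
    "cross2 (p1 - p0) (p3 - p0) < 0"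
    using cw unfolding clockwise_convex_polygon_def six all_less_6 by simp_all
  have cws: "cross2 e0 e1 < 0" "cross2 e1 e2 < 0" "cross2 e2 e3 < 0" "cross2 e3 e4 < 0"
    "cross2 e4 e5 < 0"
    using left unfolding e cross2_def by (simp_all add: algebra_simps)
  have p30: "p3 \<noteq> p0" using left(6) by (auto simp: cross2_def)
  have norms: "norm e0 = s" "norm e1 = s" "norm e2 = s" "norm e3 = s" "norm e4 = s" "norm e5 = s"
    using s unfolding e by (simp_all add: dist_norm norm_minus_commute)
  have inn: "v \<bullet> v = S" if "norm v = s" for v :: "real^2"
    using that by (simp add: S_def flip: power2_norm_eq_inner)
  have ang: "(q - p) \<bullet> (r - q) = S * c / 2"
    if "vertex_angle p q r = \<alpha>" "norm (q - p) = s" "norm (r - q) = s" for p q r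
  proof -
    have "cos \<alpha> = ((p - q) \<bullet> (r - q)) / S"
      using cos_vertex_angle[of p q r] that by (simp add: S_def norm_minus_commute power2_eq_square)
    then have "(p - q) \<bullet> (r - q) = S * cos \<alpha>" using S by (simp add: field_simps)
    moreover have "(q - p) \<bullet> (r - q) = - ((p - q) \<bullet> (r - q))" by (simp add: inner_simps)
    ultimately show ?thesis by (simp add: c_def)
  qed
  have angs: "e0 \<bullet> e1 = S * c / 2" "e1 \<bullet> e2 = S * c / 2" "e2 \<bullet> e3 = S * c / 2" "e3 \<bullet> e4 = S * c / 2"
    using ang a norms unfolding e by blast+
  have rec: "e'' = c *\<^sub>R e' - e"
    if "norm e = s" "norm e' = s" "norm e'' = s" "e \<bullet> e' = S * c / 2" "e' \<bullet> e'' = S * c / 2"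
      "cross2 e e' < 0" "cross2 e' e'' < 0" for e e' e''
  proof -
    have "S *\<^sub>R e'' = (2 * (S * c / 2)) *\<^sub>R e' - S *\<^sub>R e"
      using that inn by (intro edge_recursion) auto
    then have "S *\<^sub>R e'' = S *\<^sub>R (c *\<^sub>R e' - e)" by (simp add: scaleR_diff_right)
    then show ?thesis using S by simp
  qed
  have r2: "e2 = c *\<^sub>R e1 - e0" using rec norms angs cws by blast
  have r3: "e3 = c *\<^sub>R e2 - e1" using rec norms angs cws by blast
  have r4: "e4 = c *\<^sub>R e3 - e2" using rec norms angs cws by blast
  have closed: "e0 + e1 + e2 + e3 + e4 + e5 = 0" by (simp add: e)
  have angs5: "e4 \<bullet> e5 = S * c / 2" using ang a norms unfolding e by blast
  have r5: "e5 = c *\<^sub>R e4 - e3" using rec norms angs angs5 cws by blast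
  have "e0 + e1 + e2 + e3 + e4 + e5
      = ((1 + c) * (1 - c) * (1 + c)) *\<^sub>R e0 + (c^4 + c^3 - 2 * c\<^sup>2 - c + 1) *\<^sub>R e1"
    unfolding r5 r4 r3 r2 by (simp add: vec_eq_2 algebra_simps eval_nat_numeral)
  then have "((1 + c) * (1 - c) * (1 + c)) *\<^sub>R e0 + (c^4 + c^3 - 2 * c\<^sup>2 - c + 1) *\<^sub>R e1 = 0"
    using closed by simp
  \<comment> \<open>Consecutive edges are not parallel, so crossing with \<open>e1\<close> isolates
    the coefficient of \<open>e0\<close>.\<close>
  moreover have "cross2 (A *\<^sub>R e0 + B *\<^sub>R e1) e1 = A * cross2 e0 e1" for A B
    by (simp add: cross2_def algebra_simps)
  ultimately have "(1 + c) * (1 - c) * (1 + c) * cross2 e0 e1 = 0"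
    by (metis cross2_def diff_self mult_zero_left zero_index)
  then have "c = 1 \<or> c = -1" using cws(1) by auto
  moreover have False if "c = -1"
    using p30 r2 unfolding that e by simp
  ultimately have c1: "c = 1" by blast
  have e00: "e0 \<noteq> 0" using norms pos by auto
  have e1: "e1 = rot60 e0"
  proof -
    obtain a b where ab: "e1 = a *\<^sub>R e0 + b *\<^sub>R rot60 e0" using rot60_basis[OF e00] by metis
    have "e0 \<bullet> e1 = S * (a + b / 2)" unfolding ab by (simp add: inner_simps inn norms algebra_simps)
    then have "S * (a + b / 2) = S * (1 / 2)" using angs(1) c1 by simp
    then have "a + b / 2 = 1 / 2" using S by (subst (asm) mult_left_cancel) auto
    then have a: "a = (1 - b) / 2" by (simp add: field_simps)
    have "e1 \<bullet> e1 = S * (a\<^sup>2 + a * b + b\<^sup>2)"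
      unfolding ab by (simp add: inner_simps inn norms algebra_simps power2_eq_square)
    then have "a\<^sup>2 + a * b + b\<^sup>2 = 1" using inn[OF norms(2)] S by simp
    then have "b\<^sup>2 = 1" unfolding a by (simp add: power2_eq_square field_simps)
    moreover have "cross2 e0 e1 = b * cross2 e0 (rot60 e0)"
      unfolding ab by (simp add: cross2_def algebra_simps)
    then have "0 < b"
      using cws(1) by (simp add: cross2_rot60 zero_less_mult_iff not_less mult_less_0_iff)
        (metis inner_ge_zero not_less)
    ultimately have "b = 1" by (simp add: power2_eq_1_iff)
    then show ?thesis unfolding ab a by simp
  qed
  have p: "p1 = p0 + e0" "p2 = p1 + e1" "p3 = p2 + e2" "p4 = p3 + e3" "p5 = p4 + e4"
    by (simp_all add: e)
  \<comment> \<open>The center is the apex of the equilateral triangle erected on the first side, on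
    its right.\<close>
  have "[p0, p1, p2, p3, p4, p5] = hexagon (p0 + rot60 e0) (- rot60 e0)"
    unfolding p hexagon_def r4 r3 r2 c1 e1 by (simp add: rot60_minus rot60_rot60)
  moreover have "norm (- rot60 e0) = s" using norms(1) by (simp add: norm_eq_sqrt_inner)
  ultimately show ?thesis by blast
qed

text \<open>Only the vertex set is recovered, because a counterclockwise list is reversed before the
  clockwise case applies.\<close>

lemma regular_polygon_6_hexagon:
  assumes reg: "regular_polygon 6 s ps" and pos: "0 < s"
  obtains c u where "norm u = s" "set ps = set (hexagon c u)"
proof -
  obtain p0 p1 p2 p3 p4 p5 where ps: "ps = [p0, p1, p2, p3, p4, p5]"
  proof -
    have "length ps = 6" using reg by (simp add: regular_polygon_def)
    then show thesis using that by (auto simp: length_Suc_conv eval_nat_numeral)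
  qed
  obtain \<alpha> where a: "\<forall>i<6. vertex_angle (ps ! i) (cnth ps (i + 1)) (cnth ps (i + 2)) = \<alpha>"
    using reg unfolding regular_polygon_def by blast
  have six: "length ps = 6" by (simp add: ps)
  have s: "\<forall>i<6. dist (ps ! i) (cnth ps (i + 1)) = s"
    using reg unfolding regular_polygon_def by blast
  note s = s[unfolded all_less_6 six, simplified ps, simplified]
  note a = a[unfolded all_less_6 six, simplified ps, simplified]
  have "convex_polygon ps" using reg by (simp add: regular_polygon_def)
  then consider "clockwise_convex_polygon [p0, p1, p2, p3, p4, p5]"
    | "clockwise_convex_polygon [p5, p4, p3, p2, p1, p0]"
    unfolding convex_polygon_def ps by auto
  then show thesis
  proof cases
    case 1
    have "\<exists>c u. norm u = s \<and> [p0, p1, p2, p3, p4, p5] = hexagon c u"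
      by (rule clockwise_equilateral_equiangular_hexagon[OF 1, of _ \<alpha>]) (use s a pos in auto)
    then show ?thesis using that ps by metis
  next
    case 2
    have "\<exists>c u. norm u = s \<and> [p5, p4, p3, p2, p1, p0] = hexagon c u"
      by (rule clockwise_equilateral_equiangular_hexagon[OF 2, of _ \<alpha>])
        (use s a pos in \<open>simp_all add: dist_commute vertex_angle_commute\<close>)
    then obtain c u where "norm u = s" "[p5, p4, p3, p2, p1, p0] = hexagon c u" by blast
    moreover have "set ps = set [p5, p4, p3, p2, p1, p0]" unfolding ps by auto
    ultimately show ?thesis using that by metis
  qed
qed

subsection \<open>Sectors of the disk\<close>

text \<open>The circumradius of an equilateral triangle of side 2, and also that of the optimal
  cell.\<close>

definition rad :: real where "rad = 2 / sqrt 3"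

lemma rad_pos [simp]: "0 < rad" and rad_nonneg [simp]: "0 \<le> rad" and rad_sq: "rad\<^sup>2 = 4 / 3"
  by (simp_all add: rad_def power_divide)

lemma three_points_in_disk:
  fixes z a b c :: "real^2"
  assumes "dist z a \<le> rad" "dist z b \<le> rad" "dist z c \<le> rad"
    and "2 \<le> dist a b" "2 \<le> dist b c" "2 \<le> dist c a"
  shows "dist z a = rad" "dist z b = rad" "dist z c = rad"
    "dist a b = 2" "dist b c = 2" "dist c a = 2" "(a - z) + (b - z) + (c - z) = 0"
proof -
  define A B C where abc: "A = a - z" "B = b - z" "C = c - z"
  define s where "s = A + B + C"
  have "(dist a b)\<^sup>2 + (dist b c)\<^sup>2 + (dist c a)\<^sup>2
      = (A - B) \<bullet> (A - B) + (B - C) \<bullet> (B - C) + (C - A) \<bullet> (C - A)"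
    by (simp add: abc dist_norm power2_norm_eq_inner)
  also have "\<dots> = 3 * (A \<bullet> A + B \<bullet> B + C \<bullet> C) - s \<bullet> s"
    by (simp add: s_def algebra_simps inner_simps inner_commute)
  also have "\<dots> = 3 * ((dist z a)\<^sup>2 + (dist z b)\<^sup>2 + (dist z c)\<^sup>2) - (norm s)\<^sup>2"
    by (simp add: abc dist_norm power2_norm_eq_inner norm_minus_commute)
  finally have id: "(dist a b)\<^sup>2 + (dist b c)\<^sup>2 + (dist c a)\<^sup>2
      = 3 * ((dist z a)\<^sup>2 + (dist z b)\<^sup>2 + (dist z c)\<^sup>2) - (norm s)\<^sup>2" .
  have le: "(dist z a)\<^sup>2 \<le> 4/3" "(dist z b)\<^sup>2 \<le> 4/3" "(dist z c)\<^sup>2 \<le> 4/3"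
    using assms(1-3) by (simp_all flip: rad_sq add: power_mono)
  have ge: "4 \<le> (dist a b)\<^sup>2" "4 \<le> (dist b c)\<^sup>2" "4 \<le> (dist c a)\<^sup>2"
    using assms(4-6)[THEN power_mono, of 2] by simp_all
  have s0: "0 \<le> (norm s)\<^sup>2" by simp
  have "4 / 3 \<le> (dist z a)\<^sup>2" "4 / 3 \<le> (dist z b)\<^sup>2" "4 / 3 \<le> (dist z c)\<^sup>2"
    using id le ge s0 by argo+
  then have "(dist z a)\<^sup>2 = rad\<^sup>2" "(dist z b)\<^sup>2 = rad\<^sup>2" "(dist z c)\<^sup>2 = rad\<^sup>2"
    unfolding rad_sq using le by (blast intro: antisym)+
  then show "dist z a = rad" "dist z b = rad" "dist z c = rad" by (simp_all add: less_imp_le)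
  have "(dist a b)\<^sup>2 \<le> 4" "(dist b c)\<^sup>2 \<le> 4" "(dist c a)\<^sup>2 \<le> 4"
    using id le ge s0 by argo+
  then have "(dist a b)\<^sup>2 = 2\<^sup>2" "(dist b c)\<^sup>2 = 2\<^sup>2" "(dist c a)\<^sup>2 = 2\<^sup>2"
    using ge by (auto intro: antisym)
  then show "dist a b = 2" "dist b c = 2" "dist c a = 2" by (simp_all only: power2_eq_iff_nonneg zero_le_dist zero_le_numeral)
  have "(norm s)\<^sup>2 \<le> 0" using id le ge s0 by argo
  then show "(a - z) + (b - z) + (c - z) = 0" by (simp add: s_def abc)
qed

text \<open>The part of the open disk of radius \<open>rad\<close> about the origin that is seen from the origin through
  the arc cut off by the perpendicular bisector of \<open>0\<close> and \<open>y\<close>.\<close>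

definition sector :: "real^2 \<Rightarrow> (real^2) set" where
  "sector y = {z \<in> ball 0 rad. norm z * (y \<bullet> y) < 2 * rad * (z \<bullet> y)}"

text \<open>A full closed cone, not cut off by the disk: finite unions stay closed under limits, and
  points on the circle itself can be tested for membership.\<close>

definition closed_sector :: "real^2 \<Rightarrow> (real^2) set" where
  "closed_sector y = {z. norm z * (y \<bullet> y) \<le> 2 * rad * (z \<bullet> y)}"

lemma open_sector: "open (sector y)"
proof -
  have "sector y = ball 0 rad \<inter> {z. norm z * (y \<bullet> y) < 2 * rad * (z \<bullet> y)}"
    by (auto simp: sector_def)
  also have "open \<dots>" by (intro open_Int open_Collect_less continuous_intros) auto
  finally show ?thesis .
qed

lemma sector_subset_ball: "sector y \<subseteq> ball 0 rad"
  by (auto simp: sector_def)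

lemma closed_closed_sector: "closed (closed_sector y)"
  unfolding closed_sector_def by (intro closed_Collect_le continuous_intros)

lemma dist_le_norm_iff: "dist z y \<le> norm z \<longleftrightarrow> y \<bullet> y \<le> 2 * (z \<bullet> (y::real^2))"
proof -
  have "dist z y \<le> norm z \<longleftrightarrow> (dist z y)\<^sup>2 \<le> (norm z)\<^sup>2"
    by (metis norm_ge_zero power2_le_imp_le power_mono zero_le_dist)
  also have "\<dots> \<longleftrightarrow> y \<bullet> y \<le> 2 * (z \<bullet> y)"
    by (simp add: dist_norm power2_norm_eq_inner inner_simps inner_commute)
  finally show ?thesis .
qed

lemma dist_less_norm_iff: "dist z y < norm z \<longleftrightarrow> y \<bullet> y < 2 * (z \<bullet> (y::real^2))"
proof -
  have "dist z y < norm z \<longleftrightarrow> (dist z y)\<^sup>2 < (norm z)\<^sup>2"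
    by (metis norm_ge_zero power2_less_imp_less power_strict_mono zero_le_dist zero_less_numeral)
  also have "\<dots> \<longleftrightarrow> y \<bullet> y < 2 * (z \<bullet> y)"
    by (simp add: dist_norm power2_norm_eq_inner inner_simps inner_commute)
  finally show ?thesis .
qed

text \<open>The inequality in \<open>sector\<close> is homogeneous in \<open>z\<close>, so
  \<open>z\<close> can be pushed radially to the circle, where it says that the point is closer to
  \<open>y\<close> than to the origin.\<close>

lemma sector_project:
  assumes "z \<in> sector y"
  shows "z \<noteq> 0" "dist ((rad / norm z) *\<^sub>R z) y < rad"
proof -
  show "z \<noteq> 0" using assms by (auto simp: sector_def)
  then have n: "0 < norm z" by simp
  have "y \<bullet> y < 2 * (((rad / norm z) *\<^sub>R z) \<bullet> y)"
    using assms n by (simp add: sector_def field_simps)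
  then have "dist ((rad / norm z) *\<^sub>R z) y < norm ((rad / norm z) *\<^sub>R z)"
    by (simp only: dist_less_norm_iff)
  then show "dist ((rad / norm z) *\<^sub>R z) y < rad" using n rad_pos by simp
qed

text \<open>A common point pushed to the circle would be strictly within \<open>rad\<close> of
  \<open>y\<close> and \<open>y'\<close>, against the equality case for \<open>0\<close>,
  \<open>y\<close>, \<open>y'\<close>.\<close>

lemma sectors_disjoint:
  assumes "2 \<le> norm y" "2 \<le> norm y'" "2 \<le> dist y y'"
  shows "sector y \<inter> sector y' = {}"
proof (rule ccontr)
  assume "sector y \<inter> sector y' \<noteq> {}"
  then obtain z where z: "z \<in> sector y" "z \<in> sector y'" by blast
  define v where "v = (rad / norm z) *\<^sub>R z"
  have 1: "dist v y < rad" "dist v y' < rad" using sector_project z unfolding v_def by auto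
  have "norm v = rad" using sector_project(1)[OF z(1)] rad_pos by (simp add: v_def)
  then have "dist v y = rad" using 1 assms by (intro three_points_in_disk(2)[of v 0 y y']) auto
  then show False using 1 by simp
qed

lemma cap_subset_sector:
  assumes "z \<in> ball 0 rad" "y \<bullet> y < 2 * (z \<bullet> y)" 
  shows "z \<in> sector y"
proof -
  have "norm z * (y \<bullet> y) \<le> rad * (y \<bullet> y)" using assms by (intro mult_right_mono) auto
  also have "\<dots> < rad * (2 * (z \<bullet> y))" using assms by simp
  finally show ?thesis using assms by (simp add: sector_def)
qed

text \<open>From distance \<open>2 * rad\<close> on, the bisector misses the open disk. This reduces
  the problem to finitely many offsets.\<close>

lemma sector_empty:
  assumes "2 * rad \<le> norm y"
  shows "sector y = {}"
proof -
  have "2 * rad * (z \<bullet> y) \<le> norm z * (y \<bullet> y)" for z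
  proof -
    have "2 * rad * (z \<bullet> y) \<le> 2 * rad * (norm z * norm y)"
      using Cauchy_Schwarz_ineq2[of z y] by (intro mult_left_mono) auto
    also have "\<dots> \<le> norm y * (norm z * norm y)" using assms by (intro mult_right_mono) auto
    finally show ?thesis by (simp add: power2_norm_eq_inner[symmetric] power2_eq_square mult_ac)
  qed
  then show ?thesis by (auto simp: sector_def not_less)
qed

subsection \<open>Areas of sectors\<close>

text \<open>The sector of \<open>y\<close> is the image under \<open>sector_map y\<close> of \<open>model e\<close>, where \<open>e\<close> is the square of
  \<open>norm y / 2\<close>, and its triangle is the image of \<open>model_triangle\<close> for every \<open>y\<close>. As \<open>model e\<close> shrinks when
  \<open>e\<close> grows, the proportion of the triangle is minimal for \<open>norm y = 2\<close>; no angles are compared.\<close>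

definition model :: "real \<Rightarrow> (real^2) set" where
  "model e = {x. \<bar>x$2\<bar> < x$1 \<and> e * (x$1)\<^sup>2 + (4 / 3 - e) * (x$2)\<^sup>2 < 4 / 3}"

definition model_triangle :: "(real^2) set" where
  "model_triangle = {x. \<bar>x$2\<bar> < x$1 \<and> x$1 < 1}"

text \<open>The second coordinate is scaled so that (1, 1) and (1, -1) go to the points where the
  bisector meets the circle of radius \<open>rad\<close>, while (1, 0) goes to the midpoint of that
  chord.\<close>

definition sector_map :: "real^2 \<Rightarrow> real^2 \<Rightarrow> real^2" where
  "sector_map y x = (x$1 / 2) *\<^sub>R y
     + (x$2 * sqrt (4 / (3 * (y \<bullet> y)) - 1 / 4)) *\<^sub>R vector [- y$2, y$1]"

lemma linear_sector_map: "linear (sector_map y)"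
  by (rule linearI) (simp_all add: sector_map_def algebra_simps add_divide_distrib)

lemma det_sector_map:
  "det (matrix (sector_map y)) = sqrt (4 / (3 * (y \<bullet> y)) - 1 / 4) * (y \<bullet> y) / 2"
  by (simp add: det_2 matrix_def sector_map_def axis_def inner_2 algebra_simps)


lemma inner_sector_map:
  assumes "y \<noteq> 0" "y \<bullet> y \<le> 16 / 3"
  shows "sector_map y x \<bullet> y = x$1 * (y \<bullet> y) / 2"
    and "sector_map y x \<bullet> sector_map y x
      = (y \<bullet> y) / 4 * (x$1)\<^sup>2 + (4 / 3 - (y \<bullet> y) / 4) * (x$2)\<^sup>2"
proof -
  define k where "k = sqrt (4 / (3 * (y \<bullet> y)) - 1 / 4)"
  have y0: "0 < y \<bullet> y" using assms by simp
  then have "k\<^sup>2 = 4 / (3 * (y \<bullet> y)) - 1 / 4" using assms(2) by (simp add: k_def field_simps)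
  then have k: "k\<^sup>2 * (y \<bullet> y) = 4 / 3 - (y \<bullet> y) / 4" using y0 by (simp add: field_simps)
  show "sector_map y x \<bullet> y = x$1 * (y \<bullet> y) / 2"
    by (simp add: sector_map_def inner_2 field_simps)
  have "sector_map y x \<bullet> sector_map y x = (y \<bullet> y) / 4 * (x$1)\<^sup>2 + (k\<^sup>2 * (y \<bullet> y)) * (x$2)\<^sup>2"
    unfolding sector_map_def k_def[symmetric] by (simp add: inner_2 algebra_simps power2_eq_square)
  then show "sector_map y x \<bullet> sector_map y x
      = (y \<bullet> y) / 4 * (x$1)\<^sup>2 + (4 / 3 - (y \<bullet> y) / 4) * (x$2)\<^sup>2"
    unfolding k .
qed

lemma surj_sector_map:
  assumes "y \<noteq> 0" "y \<bullet> y < 16 / 3"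
  shows "surj (sector_map y)"
proof -
  have "0 < y \<bullet> y" using assms by simp
  then have "0 < 4 / (3 * (y \<bullet> y)) - 1 / 4" using assms(2) by (simp add: field_simps)
  then have "det (matrix (sector_map y)) \<noteq> 0" using assms(1) by (simp add: det_sector_map)
  then show ?thesis
    by (metis det_nz_iff_inj linear_injective_imp_surjective linear_sector_map)
qed

lemma norm_less_rad_iff: "norm (z::real^2) < rad \<longleftrightarrow> z \<bullet> z < 4 / 3"
proof -
  have "norm z < rad \<longleftrightarrow> (norm z)\<^sup>2 < rad\<^sup>2"
    by (metis norm_ge_zero power2_less_imp_less power_strict_mono rad_nonneg zero_less_numeral)
  then show ?thesis by (simp add: rad_sq power2_norm_eq_inner)
qed

lemma sector_eq_image:
  assumes "y \<noteq> 0" "y \<bullet> y < 16 / 3"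
  shows "sector y = sector_map y ` model ((y \<bullet> y) / 4)"
proof -
  have y0: "0 < y \<bullet> y" using assms by simp
  have "sector_map y x \<in> sector y \<longleftrightarrow> x \<in> model ((y \<bullet> y) / 4)" for x
  proof -
    define z where "z = sector_map y x"
    define e where "e = (y \<bullet> y) / 4"
    have e: "e < 4 / 3" using assms(2) by (simp add: e_def)
    have zz: "z \<bullet> z = e * (x$1)\<^sup>2 + (4 / 3 - e) * (x$2)\<^sup>2"
      using inner_sector_map[of y x] assms by (simp add: z_def e_def)
    have "z \<in> sector y \<longleftrightarrow> z \<bullet> z < 4 / 3 \<and> norm z * (y \<bullet> y) < (rad * x$1) * (y \<bullet> y)"
      using inner_sector_map[of y x] assms
      by (auto simp: sector_def z_def norm_less_rad_iff mult_ac)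
    also have "norm z * (y \<bullet> y) < (rad * x$1) * (y \<bullet> y) \<longleftrightarrow> norm z < rad * x$1"
      using y0 by simp
    also have "norm z < rad * x$1 \<longleftrightarrow> 0 < x$1 \<and> (norm z)\<^sup>2 < (rad * x$1)\<^sup>2"
    proof
      assume *: "norm z < rad * x$1"
      have "0 < x$1" using * norm_ge_zero[of z] by (intro zero_less_mult_pos[OF _ rad_pos, of "x$1"]) linarith
      then show "0 < x$1 \<and> (norm z)\<^sup>2 < (rad * x$1)\<^sup>2"
        using power_strict_mono[OF *, of 2] by simp
    next
      assume "0 < x$1 \<and> (norm z)\<^sup>2 < (rad * x$1)\<^sup>2"
      then show "norm z < rad * x$1" by (intro power2_less_imp_less[of "norm z"]) auto
    qed
    \<comment> \<open>The terms with \<open>e * (x$1)^2\<close> combine into a common factor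
      \<open>4 / 3 - e\<close>, so in model coordinates the cone is the same for every
      \<open>y\<close>.\<close>
    also have "(norm z)\<^sup>2 < (rad * x$1)\<^sup>2 \<longleftrightarrow> (4 / 3 - e) * (x$2)\<^sup>2 < (4 / 3 - e) * (x$1)\<^sup>2"
      unfolding power2_norm_eq_inner zz power_mult_distrib rad_sq by (simp add: algebra_simps)
    also have "\<dots> \<longleftrightarrow> (x$2)\<^sup>2 < (x$1)\<^sup>2" using e by (intro mult_less_cancel_left_pos) simp
    also have "\<dots> \<longleftrightarrow> \<bar>x$2\<bar> < \<bar>x$1\<bar>" using abs_le_square_iff[of "x$1" "x$2"] by (metis not_le)
    finally show ?thesis by (auto simp: z_def[symmetric] model_def zz e_def)
  qed
  then show ?thesis using surj_sector_map[OF assms] by (auto simp: surj_def image_iff) metis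
qed

text \<open>Raising \<open>e\<close> moves weight in the quadratic form from the smaller square to
  the larger one, so the form grows on the cone.\<close>

lemma model_antimono:
  assumes "1 \<le> e" shows "model e \<subseteq> model 1"
proof
  fix x assume x: "x \<in> model e"
  then have "(x$2)\<^sup>2 \<le> (x$1)\<^sup>2" by (auto simp: model_def abs_le_square_iff[symmetric])
  then have "0 \<le> (e - 1) * ((x$1)\<^sup>2 - (x$2)\<^sup>2)" using assms by simp
  then show "x \<in> model 1" using x by (auto simp: model_def algebra_simps)
qed

lemma open_model: "open (model e)"
proof -
  have "model e = {x. \<bar>x$2\<bar> < x$1} \<inter> {x. e * (x$1)\<^sup>2 + (4 / 3 - e) * (x$2)\<^sup>2 < 4 / 3}"
    by (auto simp: model_def)
  also have "open \<dots>" by (intro open_Int open_Collect_less continuous_intros)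
  finally show ?thesis .
qed

lemma open_model_triangle: "open model_triangle"
proof -
  have "model_triangle = {x. \<bar>x$2\<bar> < x$1} \<inter> {x. x$1 < 1}" by (auto simp: model_triangle_def)
  also have "open \<dots>" by (intro open_Int open_Collect_less continuous_intros)
  finally show ?thesis .
qed

lemma model_triangle_subset:
  assumes "0 \<le> e" "e \<le> 4 / 3" shows "model_triangle \<subseteq> model e"
proof
  fix x assume x: "x \<in> model_triangle"
  then have 1: "0 < x$1" "x$1 < 1" "\<bar>x$2\<bar> \<le> \<bar>x$1\<bar>" by (auto simp: model_triangle_def)
  then have "(x$2)\<^sup>2 \<le> (x$1)\<^sup>2" by (simp only: abs_le_square_iff)
  then have "(4 / 3 - e) * (x$2)\<^sup>2 \<le> (4 / 3 - e) * (x$1)\<^sup>2" using assms by (intro mult_left_mono) auto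
  moreover have "(x$1)\<^sup>2 < 1" using 1 by (simp add: power_less_one_iff abs_square_less_1)
  ultimately show "x \<in> model e" using x by (auto simp: model_triangle_def model_def algebra_simps)
qed

lemma bounded_model_1: "bounded (model 1)"
proof -
  have "norm x \<le> 2" if "x \<in> model 1" for x
  proof -
    have "(x$2)\<^sup>2 \<le> (x$1)\<^sup>2" "(x$1)\<^sup>2 + (x$2)\<^sup>2 / 3 < 4 / 3"
      using that by (auto simp: model_def abs_le_square_iff[symmetric])
    moreover have "(norm x)\<^sup>2 = (x$1)\<^sup>2 + (x$2)\<^sup>2"
      unfolding power2_norm_eq_inner by (simp add: inner_2 power2_eq_square)
    ultimately have "(norm x)\<^sup>2 \<le> 2\<^sup>2" using zero_le_power2[of "x$2"] by simp
    then show ?thesis by (rule power2_le_imp_le) simp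
  qed
  then show ?thesis by (auto simp: bounded_iff)
qed

lemma lmeasurable_model: "1 \<le> e \<Longrightarrow> model e \<in> lmeasurable"
  using bounded_subset[OF bounded_model_1 model_antimono] open_model by (simp add: lmeasurable_open)

lemma lmeasurable_model_triangle: "model_triangle \<in> lmeasurable"
  using bounded_subset[OF bounded_model_1 model_triangle_subset[of 1]] open_model_triangle
  by (simp add: lmeasurable_open)

section \<open>Areas of the model regions\<close>

lemma measure_triangle:
  fixes A B C :: "real^2"
  shows "measure lebesgue (convex hull {A, B, C})
    = \<bar>(C$1 - A$1) * (B$2 - A$2) - (B$1 - A$1) * (C$2 - A$2)\<bar> / 2"
proof -
  have "compact (convex hull {A, B, C})" by (simp add: finite_imp_compact_convex_hull)
  then have "measure lebesgue (convex hull {A, B, C}) = Henstock_Kurzweil_Integration.content (convex hull {A, B, C})"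
    by (intro measure_completion) (simp add: borel_compact)
  then show ?thesis by (simp add: content_triangle)
qed

text \<open>The estimate uses a lower bound, so one inclusion suffices: the interior of the triangle
  with vertices (0, 0), (1, 1), (1, -1), read off from its three half-planes.\<close>

lemma measure_model_triangle: "1 \<le> measure lebesgue model_triangle"
proof -
  define H :: "real^2 \<Rightarrow> real \<Rightarrow> (real^2) set" where "H = (\<lambda>a c. {x. a \<bullet> x \<le> c})"
  define K where "K = H (vector [-1, 1]) 0 \<inter> H (vector [-1, -1]) 0 \<inter> H (vector [1, 0]) 1"
  define a b :: "real^2" where ab: "a = vector [1, 1]" "b = vector [1, - 1]"
  have "convex hull {0, a, b} \<subseteq> K"
    unfolding K_def H_def
    by (intro hull_minimal convex_Int convex_halfspace_le) (auto simp: ab inner_2)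
  then have "interior (convex hull {0, a, b}) \<subseteq> interior K" by (rule interior_mono)
  also have "interior K = {x. vector [-1, 1] \<bullet> x < 0} \<inter> {x. vector [-1, -1] \<bullet> x < 0}
      \<inter> {x. vector [1, 0] \<bullet> x < 1}"
    unfolding K_def H_def interior_Int by (simp add: interior_halfspace_le vec_eq_2)
  also have "\<dots> \<subseteq> model_triangle" by (auto simp: model_triangle_def inner_2)
  finally have sub: "interior (convex hull {0, a, b}) \<subseteq> model_triangle" .
  have bd: "bounded (convex hull {0, a, b})" by (simp add: bounded_convex_hull)
  have "measure lebesgue (convex hull {0, a, b}) = 1"
    by (simp add: measure_triangle ab)
  then have "measure lebesgue (interior (convex hull {0, a, b})) = 1"
    by (subst measure_interior) (simp_all add: bd negligible_convex_frontier)
  moreover have "interior (convex hull {0, a, b}) \<in> lmeasurable"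
    using bd bounded_interior lmeasurable_open by blast
  ultimately show ?thesis
    using measure_mono_fmeasurable[OF sub _ lmeasurable_model_triangle] by simp
qed

text \<open>A small disk beyond the chord still lies in the model. The strict inequality makes
  \<open>1 - t / q\<close> positive in \<open>core_measure\<close>, which the equality case rests
  on.\<close>

lemma measure_model_triangle_less: "measure lebesgue model_triangle < measure lebesgue (model 1)"
proof -
  \<comment> \<open>On the axis the model reaches from the chord at 1 to 2 / sqrt 3, which exceeds
    11 / 10; the disk has the segment from 1 to 11 / 10 as diameter.\<close>
  define c :: "real^2" where "c = vector [21 / 20, 0]"
  define U where "U = ball c (1 / 20)"
  have U: "1 < x$1" "x$1 < 11 / 10" "\<bar>x$2\<bar> < 1 / 20" if "x \<in> U" for x
  proof -
    have "\<bar>(x - c) $ i\<bar> < 1 / 20" for i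
      using component_le_norm_cart[of "x - c" i] that
      by (simp add: U_def dist_norm norm_minus_commute)
    from this[of 1] this[of 2] show "1 < x$1" "x$1 < 11 / 10" "\<bar>x$2\<bar> < 1 / 20"
      by (auto simp: c_def abs_if split: if_splits)
  qed
  have "U \<subseteq> model 1"
  proof
    fix x assume x: "x \<in> U"
    have "(x$1)\<^sup>2 \<le> (11 / 10)\<^sup>2" using U[OF x] by (intro power_mono) auto
    moreover have "\<bar>x$2\<bar>\<^sup>2 \<le> (1 / 20)\<^sup>2" using U[OF x] by (intro power_mono) auto
    ultimately have "1 * (x$1)\<^sup>2 + (4 / 3 - 1) * (x$2)\<^sup>2 < 4 / 3"
      by (simp add: power_divide)
    moreover have "\<bar>x$2\<bar> < x$1" using U[OF x] by linarith
    ultimately show "x \<in> model 1" unfolding model_def by blast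
  qed
  then have sub: "model_triangle \<union> U \<subseteq> model 1" using model_triangle_subset[of 1] by auto
  have Um: "U \<in> lmeasurable" by (simp add: U_def)
  have "x \<notin> model_triangle \<or> x \<notin> U" for x using U(1)[of x] unfolding model_triangle_def by fastforce
  then have "measure lebesgue (model_triangle \<union> U) = measure lebesgue model_triangle + measure lebesgue U"
    by (intro measure_Un_AE lmeasurable_model_triangle Um always_eventually) blast
  moreover have "0 < measure lebesgue U" by (simp add: U_def content_ball_pos)
  moreover have "measure lebesgue (model_triangle \<union> U) \<le> measure lebesgue (model 1)"
    using lmeasurable_model_triangle Um
    by (intro measure_mono_fmeasurable sub) (auto simp: lmeasurable_model)
  ultimately show ?thesis by simp
qed

section \<open>Areas of sectors and of their triangles\<close>

definition sector_triangle :: "real^2 \<Rightarrow> (real^2) set" where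
  "sector_triangle y = sector_map y ` model_triangle"

lemma inner_ge_4: "2 \<le> norm y \<Longrightarrow> 4 \<le> y \<bullet> (y::real^2)"
  using power_mono[of 2 "norm y" 2] by (simp add: power2_norm_eq_inner)

lemma inner_less_16_3:
  assumes "norm y < 2 * rad" shows "y \<bullet> (y::real^2) < 16 / 3"
proof -
  have "(norm y)\<^sup>2 < (2 * rad)\<^sup>2" using assms by (intro power_strict_mono) auto
  then show ?thesis by (simp add: power2_norm_eq_inner power_mult_distrib rad_sq)
qed

context
  fixes y :: "real^2"
  assumes y: "2 \<le> norm y" "norm y < 2 * rad"
begin

lemma offset_bounds: "y \<noteq> 0" "4 \<le> y \<bullet> y" "y \<bullet> y < 16 / 3"
  using y inner_ge_4[of y] inner_less_16_3[of y] by auto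

lemma sector_triangle_subset: "sector_triangle y \<subseteq> sector y"
  unfolding sector_triangle_def sector_eq_image[OF offset_bounds(1,3)] using offset_bounds
  by (intro image_mono model_triangle_subset) auto

lemma sector_triangle_less:
  assumes "z \<in> sector_triangle y" shows "2 * (z \<bullet> y) \<le> y \<bullet> y"
proof -
  obtain x where z: "z = sector_map y x" and "x$1 < 1"
    using assms by (auto simp: sector_triangle_def model_triangle_def)
  have "2 * (z \<bullet> y) = x$1 * (y \<bullet> y)" unfolding z using inner_sector_map(1)[of y x] offset_bounds by simp
  also have "\<dots> \<le> 1 * (y \<bullet> y)" using \<open>x$1 < 1\<close> offset_bounds by (intro mult_right_mono) auto
  finally show ?thesis by simp
qed

lemma lmeasurable_sector_triangle: "sector_triangle y \<in> lmeasurable"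
  unfolding sector_triangle_def
  by (intro measurable_linear_image linear_sector_map lmeasurable_model_triangle)

text \<open>Sector and triangle are images under the same linear map, so the determinant cancels
  from the proportion and \<open>model_antimono\<close> does the comparison. The form without
  quotients avoids division by areas.\<close>

lemma measure_sector_triangle:
  "measure lebesgue (sector_triangle y) * measure lebesgue (model 1)
    \<ge> measure lebesgue (sector y) * measure lebesgue model_triangle"
proof -
  let ?d = "\<bar>det (matrix (sector_map y))\<bar>"
  have 1: "1 \<le> (y \<bullet> y) / 4" using offset_bounds by simp
  have "measure lebesgue (sector y) = ?d * measure lebesgue (model ((y \<bullet> y) / 4))"
    unfolding sector_eq_image[OF offset_bounds(1,3)]
    by (intro measure_linear_image linear_sector_map lmeasurable_model 1)
  also have "\<dots> \<le> ?d * measure lebesgue (model 1)"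
    using 1 by (intro mult_left_mono measure_mono_fmeasurable model_antimono)
      (simp_all add: lmeasurable_model lmeasurable_model[THEN fmeasurableD])
  finally have "measure lebesgue (sector y) * measure lebesgue model_triangle
      \<le> ?d * measure lebesgue (model 1) * measure lebesgue model_triangle"
    by (intro mult_right_mono) auto
  also have "\<dots> = measure lebesgue (sector_triangle y) * measure lebesgue (model 1)"
    unfolding sector_triangle_def
    by (simp add: measure_linear_image linear_sector_map lmeasurable_model_triangle)
  finally show ?thesis .
qed

end

lemma lmeasurable_sector: "sector y \<in> lmeasurable"
proof (rule lmeasurable_open[OF _ open_sector])
  show "bounded (sector y)" by (rule bounded_subset[OF bounded_ball sector_subset_ball])
qed

lemma measure_sector_2:
  assumes "norm y = 2"
  shows "measure lebesgue (sector y) = measure lebesgue (model 1) / sqrt 3"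
proof -
  have yy: "y \<bullet> y = 4" using assms by (simp flip: power2_norm_eq_inner)
  then have "y \<noteq> 0" by auto
  then have "sector y = sector_map y ` model 1" using sector_eq_image[of y] yy by simp
  then have "measure lebesgue (sector y) = \<bar>det (matrix (sector_map y))\<bar> * measure lebesgue (model 1)"
    by (simp add: measure_linear_image linear_sector_map lmeasurable_model)
  also have "det (matrix (sector_map y)) = 2 * sqrt (1 / 12)"
    by (simp add: det_sector_map yy)
  also have "2 * sqrt (1 / 12) = sqrt (4 * (1 / 12))" by (simp only: real_sqrt_mult real_sqrt_four)
  also have "\<dots> = 1 / sqrt 3" by (simp add: real_sqrt_divide)
  finally show ?thesis by simp
qed

subsection \<open>The area bound\<close>

text \<open>Formulated on the list so that the simplifier unfolds exactly the fifteen pairs;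
  distinctness and pairwise distances on the set both follow from it.\<close>

lemma sorted_wrt_hexagon:
  assumes "u \<bullet> u = 4"
  shows "sorted_wrt (\<lambda>p q. 2 \<le> dist p q) (hexagon c u)"
proof -
  have *: "2 \<le> dist p q" if "4 \<le> (p - q) \<bullet> (p - q)" for p q :: "real^2"
    using that by (intro power2_le_imp_le[of 2]) (simp_all add: dist_norm power2_norm_eq_inner)
  have "sorted_wrt (\<lambda>p q. 4 \<le> (p - q) \<bullet> (p - q)) (hexagon c u)"
    using assms by (simp add: hexagon_def inner_simps)
  then show ?thesis by (rule sorted_wrt_mono_rel[rotated]) (rule *)
qed

lemma distinct_hexagon:
  assumes "u \<bullet> u = 4" shows "distinct (hexagon c u)"
  using sorted_wrt_hexagon[OF assms, of c] unfolding distinct_conv_nth sorted_wrt_iff_nth_less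
  by (metis dist_self linorder_neqE_nat not_numeral_le_zero)

lemma pairwise_hexagon:
  assumes "u \<bullet> u = 4" "p \<in> set (hexagon c u)" "q \<in> set (hexagon c u)" "p \<noteq> q"
  shows "2 \<le> dist p q"
  using sorted_wrt_hexagon[OF assms(1), of c] assms(2-4) unfolding sorted_wrt_iff_nth_less in_set_conv_nth
  by (metis dist_commute linorder_neqE_nat)

lemma norm_hexagon_0:
  assumes "u \<bullet> u = 4" "p \<in> set (hexagon 0 u)" shows "norm p = 2"
proof -
  have "p \<bullet> p = 4" using assms by (auto simp: hexagon_def inner_simps)
  then show ?thesis by (simp add: norm_eq_sqrt_inner)
qed

lemma sum_sectors_le:
  assumes "finite W" "\<And>w. w \<in> W \<Longrightarrow> 2 \<le> norm w" "pairwise (\<lambda>p q. 2 \<le> dist p q) W"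
  shows "measure lebesgue (\<Union>(sector ` W)) = (\<Sum>w\<in>W. measure lebesgue (sector w))"
    and "(\<Sum>w\<in>W. measure lebesgue (sector w)) \<le> measure lebesgue (ball (0::real^2) rad)"
proof -
  show eq: "measure lebesgue (\<Union>(sector ` W)) = (\<Sum>w\<in>W. measure lebesgue (sector w))"
    using assms sectors_disjoint
    by (intro measure_UNION') (auto simp: lmeasurable_sector pairwise_def disjnt_def)
  have "measure lebesgue (\<Union>(sector ` W)) \<le> measure lebesgue (ball (0::real^2) rad)"
    using assms(1) sector_subset_ball
    by (intro measure_mono_fmeasurable fmeasurableD fmeasurable.finite_UN lmeasurable_sector) auto
  then show "(\<Sum>w\<in>W. measure lebesgue (sector w)) \<le> measure lebesgue (ball (0::real^2) rad)"
    unfolding eq .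
qed

text \<open>The six sectors of a regular hexagon are disjoint. This compares the disk with the model
  directly, and pi never enters.\<close>

lemma measure_ball_rad_ge:
  "6 * (measure lebesgue (model 1) / sqrt 3) \<le> measure lebesgue (ball (0::real^2) rad)"
proof -
  define u :: "real^2" where "u = vector [2, 0]"
  define A where "A = set (hexagon 0 u)"
  have u: "u \<bullet> u = 4" by (simp add: u_def inner_2)
  have "card A = 6" using distinct_card[OF distinct_hexagon[OF u]] by (simp add: A_def)
  moreover have "measure lebesgue (sector w) = measure lebesgue (model 1) / sqrt 3" if "w \<in> A" for w
    using that norm_hexagon_0[OF u] by (intro measure_sector_2) (auto simp: A_def)
  ultimately have "(\<Sum>w\<in>A. measure lebesgue (sector w)) = 6 * (measure lebesgue (model 1) / sqrt 3)"
    by simp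
  moreover have "(\<Sum>w\<in>A. measure lebesgue (sector w)) \<le> measure lebesgue (ball (0::real^2) rad)"
    using norm_hexagon_0[OF u] pairwise_hexagon[OF u]
    by (intro sum_sectors_le) (auto simp: A_def pairwise_def)
  ultimately show ?thesis by simp
qed

text \<open>Inside the disk, a lower bound for the cell: each sector is reduced to its triangle.\<close>

definition core :: "(real^2) set \<Rightarrow> (real^2) set" where
  "core W = (ball 0 rad - \<Union>(sector ` W)) \<union> \<Union>(sector_triangle ` W)"

text \<open>\<open>W\<close> stands for the offsets whose bisectors meet the open disk; the argument
  about areas and covers sees nothing else of the collection.\<close>

locale near_offsets =
  fixes W :: "(real^2) set"
  assumes fin: "finite W"
    and near: "\<And>w. w \<in> W \<Longrightarrow> 2 \<le> norm w \<and> norm w < 2 * rad"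
    and sep: "pairwise (\<lambda>p q. 2 \<le> dist p q) W"
begin

lemma lmeasurable_core: "core W \<in> lmeasurable"
  unfolding core_def using fin near
  by (intro fmeasurable.Un fmeasurable.Diff fmeasurable.finite_UN lmeasurable_sector
      lmeasurable_sector_triangle) (auto simp: lmeasurable_sector fmeasurableD)

text \<open>With areas D of the disk, S of all sectors and T of all triangles, the core has area D -
  S + T, and T >= S t / q bounds this below by (D - S) (1 - t / q) + D t / q. The second summand is
  at least 2 sqrt 3; the first is nonnegative and vanishes only for S = D.\<close>

lemma core_measure:
  shows "2 * sqrt 3 \<le> measure lebesgue (core W)"
    and "measure lebesgue (core W) = 2 * sqrt 3 \<Longrightarrow> measure lebesgue (ball 0 rad - \<Union>(sector ` W)) = 0"
proof -
  let ?m = "measure lebesgue"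
  let ?D = "?m (ball (0::real^2) rad)"
  define S where "S = (\<Sum>w\<in>W. ?m (sector w))"
  define T where "T = (\<Sum>w\<in>W. ?m (sector_triangle w))"
  define q where "q = ?m (model 1)"
  define t where "t = ?m model_triangle"
  have t: "1 \<le> t" "t < q" using measure_model_triangle measure_model_triangle_less by (simp_all add: t_def q_def)
  have near2: "\<And>w. w \<in> W \<Longrightarrow> 2 \<le> norm w" using near by blast
  have UnT: "\<Union>(sector_triangle ` W) \<in> lmeasurable" "\<Union>(sector ` W) \<in> lmeasurable"
    using fin near by (auto intro!: fmeasurable.finite_UN lmeasurable_sector_triangle lmeasurable_sector)
  have mT: "?m (\<Union>(sector_triangle ` W)) = T" unfolding T_def
  proof (intro measure_UNION' fin pairwiseI)
    fix w w' assume w: "w \<in> W" "w' \<in> W" "w \<noteq> w'"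
    then have "sector w \<inter> sector w' = {}" using sep near2 by (intro sectors_disjoint) (auto simp: pairwise_def)
    then show "disjnt (sector_triangle w) (sector_triangle w')"
      using sector_triangle_subset near w unfolding disjnt_def by blast
  qed (use near in \<open>auto intro: lmeasurable_sector_triangle\<close>)
  have SD: "S \<le> ?D" unfolding S_def using fin near2 sep by (rule sum_sectors_le)
  have mS: "?m (\<Union>(sector ` W)) = S" unfolding S_def using fin near2 sep by (rule sum_sectors_le)
  have diff: "?m (ball 0 rad - \<Union>(sector ` W)) = ?D - S"
    unfolding mS[symmetric] using UnT sector_subset_ball by (intro measurable_measure_Diff) (auto simp: fmeasurableD)
  have "(ball 0 rad - \<Union>(sector ` W)) \<inter> \<Union>(sector_triangle ` W) = {}"
    using sector_triangle_subset near by blast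
  then have "?m (core W) = ?m (ball 0 rad - \<Union>(sector ` W)) + ?m (\<Union>(sector_triangle ` W))"
    unfolding core_def using UnT
    by (intro measure_Un_AE always_eventually fmeasurable.Diff) (auto simp: fmeasurableD)
  then have core: "?m (core W) = ?D - S + T" by (simp add: diff mT)
  have "S * t \<le> T * q"
    unfolding S_def T_def sum_distrib_right q_def t_def using near
    by (intro sum_mono) (simp add: measure_sector_triangle)
  then have "S * (t / q) \<le> T" using t by (simp add: field_simps)
  then have ge: "(?D - S) * (1 - t / q) + ?D * (t / q) \<le> ?m (core W)"
    unfolding core by (simp add: algebra_simps)
  have "6 / sqrt 3 * q * (t / q) \<le> ?D * (t / q)"
    using measure_ball_rad_ge t by (intro mult_right_mono) (auto simp: q_def)
  also have "6 / sqrt 3 * q * (t / q) = 6 / sqrt 3 * t" using t by simp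
  also have "6 / sqrt 3 = 2 * sqrt 3" by (simp add: field_simps)
  finally have "2 * sqrt 3 * t \<le> ?D * (t / q)" .
  moreover have "2 * sqrt 3 * 1 \<le> 2 * sqrt 3 * t" using t by (intro mult_left_mono) auto
  ultimately have D: "2 * sqrt 3 \<le> ?D * (t / q)" by linarith
  have pos: "0 < 1 - t / q" using t by simp
  have nn: "0 \<le> (?D - S) * (1 - t / q)" using SD pos by simp
  show "2 * sqrt 3 \<le> ?m (core W)" using ge D nn by linarith
  assume "?m (core W) = 2 * sqrt 3"
  then have "(?D - S) * (1 - t / q) \<le> 0" using ge D by linarith
  then have "?D - S \<le> 0" using pos by (simp add: mult_le_0_iff)
  then show "?m (ball 0 rad - \<Union>(sector ` W)) = 0" using SD diff by simp
qed

text \<open>The points of the open disk outside finitely many closed cones form an open set, which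
  is empty if it is a null set.\<close>

lemma sectors_cover:
  assumes "measure lebesgue (ball 0 rad - \<Union>(sector ` W)) = 0"
  shows "ball 0 rad \<subseteq> \<Union>(closed_sector ` W)"
proof (rule ccontr)
  define U where "U = ball 0 rad - \<Union>(closed_sector ` W)"
  assume "\<not> ball 0 rad \<subseteq> \<Union>(closed_sector ` W)"
  then have "U \<noteq> {}" by (auto simp: U_def)
  have "open U" unfolding U_def using fin closed_closed_sector by (intro open_Diff closed_UN) auto
  have "sector w \<subseteq> closed_sector w" for w by (auto simp: sector_def closed_sector_def)
  then have "U \<subseteq> ball 0 rad - \<Union>(sector ` W)" unfolding U_def by blast
  moreover have "negligible (ball 0 rad - \<Union>(sector ` W))"
    unfolding negligible_iff_measure using assms fin
    by (auto intro!: fmeasurable.Diff fmeasurable.finite_UN lmeasurable_sector fmeasurableD)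
  ultimately have "negligible U" by (rule negligible_subset[rotated])
  then show False using open_not_negligible \<open>open U\<close> \<open>U \<noteq> {}\<close> by blast
qed

lemma rot60_offset:
  assumes cover: "ball 0 rad \<subseteq> \<Union>(closed_sector ` W)" and y: "y \<in> W"
  shows "norm y = 2" "rot60 y \<in> W"
proof -
  have ny: "2 \<le> norm y" "norm y < 2 * rad" using near y by auto
  note yf = offset_bounds[OF ny]
  \<comment> \<open>The clockwise end of the arc of \<open>y\<close>, matching the direction of
    \<open>rot60\<close>.\<close>
  define v where "v = sector_map y (vector [1, -1])"
  have vy: "v \<bullet> y = (y \<bullet> y) / 2" and vv: "v \<bullet> v = 4 / 3"
    using inner_sector_map[of y] yf by (simp_all add: v_def)
  have nv: "norm v = rad" using real_sqrt_unique[of rad "4 / 3"] by (simp add: norm_eq_sqrt_inner vv rad_sq)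
  \<comment> \<open>A path to \<open>v\<close> inside the open disk and outside the closed sector of
    \<open>y\<close>. Moving against \<open>y\<close> leaves the sector, and shrinking by
    \<open>1 - s\<close> makes up for the move, whose length stays below \<open>s * rad / 2\<close>
    because \<open>norm y < 2 * rad\<close>.\<close>
  define p where "p s = (1 - s) *\<^sub>R v - (s / 4) *\<^sub>R y" for s
  define C where "C = \<Union>(closed_sector ` (W - {y}))"
  have pC: "p s \<in> C" if s: "0 < s" "s < 1" for s
  proof -
    have 1: "norm ((1 - s) *\<^sub>R v) = (1 - s) * rad" using s nv by simp
    have "s * norm y < s * (2 * rad)" using ny s by simp
    then have 2: "norm ((s / 4) *\<^sub>R y) < s * rad / 2" using s by simp
    have "norm (p s) < (1 - s) * rad + s * rad / 2"
      unfolding p_def using norm_triangle_ineq4[of "(1 - s) *\<^sub>R v" "(s / 4) *\<^sub>R y"] 1 2 by linarith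
    also have "\<dots> \<le> rad" using s mult_nonneg_nonneg[of s rad] by (simp add: algebra_simps)
    finally have "p s \<in> ball 0 rad" by simp
    moreover have "(1 - s) * rad - s * rad / 2 < norm (p s)"
      unfolding p_def using norm_triangle_ineq2[of "(1 - s) *\<^sub>R v" "(s / 4) *\<^sub>R y"] 1 2 by linarith
    then have "((1 - s) * rad - s * rad / 2) * (y \<bullet> y) < norm (p s) * (y \<bullet> y)"
      using yf by (intro mult_strict_right_mono) auto
    then have "p s \<notin> closed_sector y"
      by (simp add: closed_sector_def p_def inner_simps vy algebra_simps)
    ultimately show "p s \<in> C" using cover by (auto simp: C_def)
  qed
  \<comment> \<open>The other closed sectors contain the whole path, hence also its limit
    \<open>v\<close>.\<close>
  have "closed C" unfolding C_def using fin closed_closed_sector by (intro closed_UN) auto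
  moreover have "(p \<longlongrightarrow> p 0) (at_right 0)" unfolding p_def by (intro tendsto_intros) simp
  moreover have "\<forall>\<^sub>F s in at_right 0. p s \<in> C"
    using pC eventually_at_right_real[of 0 "1::real"] by (auto elim: eventually_mono)
  ultimately have "p 0 \<in> C" by (intro Lim_in_closed_set[of C p "at_right 0"]) auto
  then obtain y' where y': "y' \<in> W" "y' \<noteq> y" "v \<in> closed_sector y'" by (auto simp: C_def p_def)
  have "rad * (y' \<bullet> y') \<le> rad * (2 * (v \<bullet> y'))" using y'(3) by (simp add: closed_sector_def nv)
  then have "dist v y' \<le> norm v" unfolding dist_le_norm_iff by simp
  moreover have "dist v y \<le> norm v" unfolding dist_le_norm_iff using vy by simp
  ultimately have d: "dist v 0 \<le> rad" "dist v y \<le> rad" "dist v y' \<le> rad" using nv by simp_all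
  have s: "2 \<le> dist 0 y" "2 \<le> dist y y'" "2 \<le> dist y' 0"
    using near y y' sep by (auto simp: pairwise_def)
  show n2: "norm y = 2" using three_points_in_disk(4)[OF d s] by simp
  then have yy: "y \<bullet> y = 4" by (simp flip: power2_norm_eq_inner)
  have "sqrt (1 / 12) = sqrt 3 / 6"
    by (rule real_sqrt_unique) (simp_all add: power_divide)
  then have v: "v = (1 / 2) *\<^sub>R y - (sqrt 3 / 6) *\<^sub>R vector [- y$2, y$1]"
    by (simp add: v_def sector_map_def yy)
  \<comment> \<open>The circumcenter \<open>v\<close> of the equilateral triangle \<open>0\<close>,
    \<open>y\<close>, \<open>y'\<close> is its centroid, which determines \<open>y'\<close>.\<close>
  have "(0 - v) + (y - v) + (y' - v) = 0" by (rule three_points_in_disk(7)[OF d s])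
  then have "y' = 3 *\<^sub>R v - y" by (auto simp: vec_eq_2)
  also have "\<dots> = rot60 y" by (simp add: v vec_eq_2 field_simps)
  finally show "rot60 y \<in> W" using y' by simp
qed

end

subsection \<open>Offsets of the occupied points\<close>

definition offsets :: "(real^2) set \<Rightarrow> real^2 \<Rightarrow> (real^2) set" where
  "offsets X x = (\<lambda>y. y - x) ` (X - {x})"

lemma offsets_iff: "w \<in> offsets X x \<longleftrightarrow> x + w \<in> X \<and> w \<noteq> 0"
  by (auto simp: offsets_def image_iff algebra_simps intro: bexI[of _ "x + w"])

text \<open>This includes the one-point collection: the infimum over the empty set is infinite in
  the extended reals.\<close>

lemma voronoi_cell_dist_iff:
  "z \<in> voronoi_cell X x \<longleftrightarrow> (\<forall>y\<in>X - {x}. dist x z \<le> dist y z)"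
  by (simp add: voronoi_cell_def le_INF_iff)

lemma voronoi_cell_iff:
  "z \<in> voronoi_cell X x \<longleftrightarrow> (\<forall>w\<in>offsets X x. 2 * ((z - x) \<bullet> w) \<le> w \<bullet> w)"
proof -
  have "dist x z \<le> dist y z \<longleftrightarrow> 2 * ((z - x) \<bullet> (y - x)) \<le> (y - x) \<bullet> (y - x)" for y
  proof -
    have "dist x z \<le> dist y z \<longleftrightarrow> \<not> dist (z - x) (y - x) < norm (z - x)"
      by (simp add: not_less dist_norm norm_minus_commute)
    then show ?thesis unfolding dist_less_norm_iff not_less .
  qed
  then show ?thesis by (simp add: voronoi_cell_dist_iff offsets_def)
qed

lemma voronoi_cell_eq:
  "voronoi_cell X x = (\<Inter>w\<in>offsets X x. {z. w \<bullet> z \<le> (w \<bullet> w) / 2 + w \<bullet> x})"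
proof -
  have "2 * ((z - x) \<bullet> w) \<le> w \<bullet> w \<longleftrightarrow> w \<bullet> z \<le> (w \<bullet> w) / 2 + w \<bullet> x" for z w
    unfolding inner_diff_left inner_commute[of z w] inner_commute[of x w] by argo
  then show ?thesis by (auto simp: voronoi_cell_iff)
qed

lemma closed_voronoi_cell: "closed (voronoi_cell X x)"
  unfolding voronoi_cell_eq by (intro closed_INT ballI closed_halfspace_le)

lemma convex_voronoi_cell: "convex (voronoi_cell X x)"
  unfolding voronoi_cell_eq by (intro convex_INT convex_halfspace_le)

context
  fixes X :: "(real^2) set" and x :: "real^2"
  assumes adm: "admissible X" and x: "x \<in> X"
begin

lemma offsets_norm: "w \<in> offsets X x \<Longrightarrow> 2 \<le> norm w"
  using adm x unfolding offsets_iff admissible_def pairwise_def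
  by (metis add.right_neutral add_left_cancel dist_add_cancel dist_0_norm)

lemma offsets_inner: "w \<in> offsets X x \<Longrightarrow> 4 \<le> w \<bullet> w"
  using offsets_norm inner_ge_4 by blast

lemma offsets_pairwise: "pairwise (\<lambda>p q. 2 \<le> dist p q) (offsets X x)"
  using adm unfolding admissible_def pairwise_def offsets_def by (auto simp: dist_norm)

text \<open>An infinite bounded set has a limit point, and two of its points within distance 1 of
  that limit would be less than 2 apart.\<close>

lemma finite_near_offsets: "finite {w \<in> offsets X x. norm w < 2 * rad}" (is "finite ?F")
proof (rule ccontr)
  assume inf: "infinite ?F"
  have "bounded ?F" by (rule boundedI[of _ "2 * rad"]) auto
  then obtain l where "l islimpt ?F" using inf bounded_infinite_imp_islimpt[of ?F ?F] by blast
  then have inf_l: "infinite (?F \<inter> ball l 1)" unfolding islimpt_eq_infinite_ball using zero_less_one by blast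
  then obtain p where p: "p \<in> ?F \<inter> ball l 1" using infinite_imp_nonempty by blast
  have "infinite (?F \<inter> ball l 1 - {p})" using inf_l by simp
  then obtain q where "q \<in> ?F \<inter> ball l 1 - {p}" using infinite_imp_nonempty by blast
  with p have pq: "p \<in> ?F \<inter> ball l 1" "q \<in> ?F \<inter> ball l 1" "p \<noteq> q" by auto
  have "dist p q < 2" using pq dist_triangle_half_r[of l p 2 q] by simp
  moreover have "2 \<le> dist p q" using pq offsets_pairwise by (auto simp: pairwise_def)
  ultimately show False by simp
qed

interpretation near_offsets "{w \<in> offsets X x. norm w < 2 * rad}"
  using finite_near_offsets offsets_norm offsets_pairwise
  by unfold_locales (auto simp: pairwise_def)

abbreviation near_set :: "(real^2) set" where "near_set \<equiv> {w \<in> offsets X x. norm w < 2 * rad}"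

text \<open>Within the disk, a cap lies in its own sector and the sectors are disjoint. So a point
  outside all sectors is in no cap, and a point in the triangle of \<open>y\<close> could only be in
  the cap of \<open>y\<close>, which the triangle avoids.\<close>

lemma translated_core_subset: "(+) x ` core near_set \<subseteq> voronoi_cell X x"
proof clarify
  fix z assume z: "z \<in> core near_set"
  have caps: "z \<in> sector w" "norm w < 2 * rad"
    if "w \<in> offsets X x" "z \<in> ball 0 rad" "\<not> 2 * (z \<bullet> w) \<le> w \<bullet> w" for w
  proof -
    show "z \<in> sector w" using that by (intro cap_subset_sector) auto
    then show "norm w < 2 * rad" using sector_empty[of w] by (cases "2 * rad \<le> norm w") auto
  qed
  have "2 * (z \<bullet> w) \<le> w \<bullet> w" if w: "w \<in> offsets X x" for w
  proof (rule ccontr)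
    assume not_le: "\<not> 2 * (z \<bullet> w) \<le> w \<bullet> w"
    from z consider "z \<in> ball 0 rad" "\<forall>y\<in>near_set. z \<notin> sector y"
      | y where "y \<in> near_set" "z \<in> sector_triangle y" unfolding core_def by blast
    then show False
    proof cases
      case 1
      then show False using caps[OF w] w not_le by blast
    next
      case 2
      have y: "2 \<le> norm y" "norm y < 2 * rad" "y \<in> offsets X x" using 2 offsets_norm by auto
      have zy: "z \<in> sector y" using sector_triangle_subset[OF y(1,2)] 2 by blast
      have "z \<in> sector w" using caps[OF w _ not_le] zy sector_subset_ball by blast
      moreover have "w \<noteq> y" using sector_triangle_less[OF y(1,2)] 2 not_le by blast
      then have "sector w \<inter> sector y = {}"
        using offsets_pairwise w y offsets_norm by (intro sectors_disjoint) (auto simp: pairwise_def)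
      ultimately show False using zy by blast
    qed
  qed
  then show "x + z \<in> voronoi_cell X x" by (simp add: voronoi_cell_iff)
qed

text \<open>Stated in \<open>ennreal\<close> because the cell may have infinite area.\<close>

lemma emeasure_core_le:
  "ennreal (measure lebesgue (core near_set)) \<le> emeasure lebesgue (voronoi_cell X x)"
proof -
  have "ennreal (measure lebesgue (core near_set)) = emeasure lebesgue ((+) x ` core near_set)"
    using measurable_translation[OF lmeasurable_core] by (simp add: emeasure_eq_measure2 measure_translation)
  also have "\<dots> \<le> emeasure lebesgue (voronoi_cell X x)"
    by (intro emeasure_mono translated_core_subset sets_completionI_sets)
      (simp add: closed_voronoi_cell borel_closed)
  finally show ?thesis .
qed

lemma emeasure_voronoi_cell_ge: "ennreal (2 * sqrt 3) \<le> emeasure lebesgue (voronoi_cell X x)"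
  using core_measure(1) emeasure_core_le by (meson ennreal_leI order_trans)

lemma minimal_cell_hexagon:
  assumes "emeasure lebesgue (voronoi_cell X x) = ennreal (2 * sqrt 3)"
  obtains w where "w \<bullet> w = 4" "set (hexagon x w) \<subseteq> X"
proof -
  have "measure lebesgue (core near_set) \<le> 2 * sqrt 3"
    using emeasure_core_le unfolding assms by (subst (asm) ennreal_le_iff) auto
  then have "measure lebesgue (core near_set) = 2 * sqrt 3" using core_measure(1) by linarith
  then have cover: "ball 0 rad \<subseteq> \<Union>(closed_sector ` near_set)"
    using core_measure(2) sectors_cover by blast
  \<comment> \<open>The origin lies in every closed sector; that it is covered shows merely that
    some near offset exists from which to start rotating.\<close>
  have "0 \<in> ball (0::real^2) rad" by simp
  then obtain w where w: "w \<in> near_set" using cover by blast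
  have "(rot60 ^^ k) w \<in> near_set" for k
    by (induction k) (use w rot60_offset(2)[OF cover] in auto)
  then have "set (hexagon x w) \<subseteq> X" by (auto simp: set_hexagon offsets_iff)
  moreover have "w \<bullet> w = 4" using rot60_offset(1)[OF cover w] by (simp flip: power2_norm_eq_inner)
  ultimately show ?thesis using that by blast
qed

end

subsection \<open>Cells with six neighbors in hexagonal position\<close>

lemma funpow_rot60_normal:
  "(rot60 ^^ k) (v + rot60 v) = (rot60 ^^ k) v + rot60 ((rot60 ^^ k) v)"
  using funpow_swap1[of rot60 k v] by (simp add: funpow_rot60_add)

lemma add_rot60_inner: "(v + rot60 v) \<bullet> (v + rot60 v) = 3 * (v \<bullet> v)"
  by (simp add: inner_simps)

lemma rot60_side_normal:
  "v \<bullet> (v + rot60 v) = 3 / 2 * (v \<bullet> v)" "rot60 v \<bullet> (v + rot60 v) = 3 / 2 * (v \<bullet> v)"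
  by (simp_all add: inner_simps)

text \<open>Passes from the neighbors to the vertices of the cell: the reflection of the center in
  the side from \<open>v\<close> to \<open>rot60 v\<close> is twice the midpoint,
  \<open>v + rot60 v\<close>.\<close>

lemma hexagon_vertex_of_normal:
  obtains v where "w = v + rot60 v" "v \<bullet> v = (w \<bullet> w) / 3"
proof
  \<comment> \<open>For the rotation R, R^2 = R - 1 gives (1 + R) (2 - R) = 3, so this inverts 1 +
    R.\<close>
  define v where "v = (1 / 3) *\<^sub>R (2 *\<^sub>R w - rot60 w)"
  show "w = v + rot60 v" by (simp add: v_def vec_eq_2 field_simps sqrt3_mult)
  then have "w \<bullet> w = 3 * (v \<bullet> v)" using add_rot60_inner[of v] by simp
  then show "v \<bullet> v = (w \<bullet> w) / 3" by simp
qed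

text \<open>Rotating \<open>v\<close> leaves the vertex set unchanged, so one normal tested at six
  vertices settles all six normals.\<close>

lemma hull_hexagon_le:
  assumes "p \<in> convex hull set (hexagon c v)" "w \<in> set (hexagon 0 (v + rot60 v))"
  shows "2 * ((p - c) \<bullet> w) \<le> w \<bullet> w"
proof -
  obtain k where w: "w = (rot60 ^^ k) (v + rot60 v)" using assms(2) by (auto simp: set_hexagon)
  define v' where "v' = (rot60 ^^ k) v"
  have w': "w = v' + rot60 v'"
    by (simp add: w v'_def funpow_rot60_normal)
  have vv: "0 \<le> v' \<bullet> v'" by simp
  have "set (hexagon c v') \<subseteq> {p. w \<bullet> p \<le> (w \<bullet> w) / 2 + w \<bullet> c}"
    using vv by (simp add: hexagon_def w' inner_simps)
  then have "convex hull set (hexagon c v') \<subseteq> {p. w \<bullet> p \<le> (w \<bullet> w) / 2 + w \<bullet> c}"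
    by (rule hull_minimal) (rule convex_halfspace_le)
  then have "w \<bullet> p \<le> (w \<bullet> w) / 2 + w \<bullet> c" using assms(1) by (auto simp: v'_def)
  then show ?thesis by (simp add: inner_diff_left inner_commute[of p] inner_commute[of c])
qed

text \<open>In the cone that contains \<open>p - c\<close>, the half-plane of that cone's own normal
  bounds the coordinate sum by 1. This yields both the converse of \<open>hull_hexagon_le\<close>
  and the area of the hexagon.\<close>

lemma hexagon_triangle:
  assumes "v \<noteq> 0" and le: "\<And>w. w \<in> set (hexagon 0 (v + rot60 v)) \<Longrightarrow> 2 * ((p - c) \<bullet> w) \<le> w \<bullet> w"
  obtains k where "k < 6"
    "p \<in> convex hull {c, c + (rot60 ^^ k) v, c + rot60 ((rot60 ^^ k) v)}"
proof -
  obtain k a b where k: "k < 6" and ab: "0 \<le> a" "0 \<le> b"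
    and p: "p - c = a *\<^sub>R (rot60 ^^ k) v + b *\<^sub>R rot60 ((rot60 ^^ k) v)"
    using hexagon_sector[OF assms(1)] by metis
  define v' where "v' = (rot60 ^^ k) v"
  have "v' + rot60 v' \<in> set (hexagon 0 (v + rot60 v))"
    using funpow_rot60_in_hexagon[of 0 k "v + rot60 v"]
    by (simp add: v'_def funpow_rot60_normal)
  then have "2 * ((p - c) \<bullet> (v' + rot60 v')) \<le> 3 * (v' \<bullet> v')" using le add_rot60_inner by metis
  also have "(p - c) \<bullet> (v' + rot60 v') = (a + b) * (3 / 2 * (v' \<bullet> v'))"
    unfolding p v'_def[symmetric] inner_add_left inner_scaleR_left rot60_side_normal
    by (simp add: algebra_simps)
  finally have "(a + b) * (v' \<bullet> v') \<le> 1 * (v' \<bullet> v')" by simp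
  moreover have "0 < v' \<bullet> v'" using assms(1) by (simp add: v'_def)
  ultimately have "a + b \<le> 1" by (simp only: mult_le_cancel_right_pos)
  moreover have "p = (1 - a - b) *\<^sub>R c + a *\<^sub>R (c + v') + b *\<^sub>R (c + rot60 v')"
    using p unfolding v'_def[symmetric] by (simp add: algebra_simps)
  ultimately have "p \<in> convex hull {c, c + v', c + rot60 v'}"
    unfolding convex_hull_3 using ab by (intro CollectI exI[of _ "1 - a - b"] exI[of _ a] exI[of _ b]) auto
  then show ?thesis using that[OF k] by (simp add: v'_def)
qed

lemma center_in_hull_hexagon: "c \<in> convex hull set (hexagon c v)"
proof -
  have "(1 / 2) *\<^sub>R (c + v) + (1 / 2) *\<^sub>R (c - v) \<in> convex hull set (hexagon c v)"
    by (intro convexD[OF convex_convex_hull] hull_inc) (auto simp: hexagon_def)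
  moreover have "(1 / 2) *\<^sub>R (c + v) + (1 / 2) *\<^sub>R (c - v) = c"
    by (simp add: vec_eq_2 field_simps)
  ultimately show ?thesis by simp
qed

lemma hull_hexagon_iff:
  assumes "v \<noteq> 0"
  shows "p \<in> convex hull set (hexagon c v)
    \<longleftrightarrow> (\<forall>w\<in>set (hexagon 0 (v + rot60 v)). 2 * ((p - c) \<bullet> w) \<le> w \<bullet> w)"
proof
  assume "\<forall>w\<in>set (hexagon 0 (v + rot60 v)). 2 * ((p - c) \<bullet> w) \<le> w \<bullet> w"
  then obtain k where "p \<in> convex hull {c, c + (rot60 ^^ k) v, c + rot60 ((rot60 ^^ k) v)}"
    using hexagon_triangle[OF assms] by metis
  moreover have "convex hull {c, c + (rot60 ^^ k) v, c + rot60 ((rot60 ^^ k) v)}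
      \<subseteq> convex hull set (hexagon c v)"
    using center_in_hull_hexagon funpow_rot60_in_hexagon[of c k v] funpow_rot60_in_hexagon[of c "Suc k" v]
    by (intro hull_minimal convex_convex_hull) (auto intro: hull_inc)
  ultimately show "p \<in> convex hull set (hexagon c v)" by blast
qed (use hull_hexagon_le in blast)

text \<open>Subadditivity over the six covering triangles gives this direction; the opposite one is
  the general bound for cells.\<close>

lemma measure_hull_hexagon:
  assumes "v \<bullet> v = 4 / 3"
  shows "measure lebesgue (convex hull set (hexagon c v)) \<le> 2 * sqrt 3"
proof -
  have v: "v \<noteq> 0" using assms by auto
  define T where "T k = convex hull {c, c + (rot60 ^^ k) v, c + rot60 ((rot60 ^^ k) v)}" for k
  have Tm: "T k \<in> lmeasurable" for k
    unfolding T_def by (intro lmeasurable_compact finite_imp_compact_convex_hull) simp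
  have Tk: "measure lebesgue (T k) = sqrt 3 / 3" for k
  proof -
    define v' where "v' = (rot60 ^^ k) v"
    have "measure lebesgue (T k) = \<bar>cross2 v' (rot60 v')\<bar> / 2"
      unfolding T_def v'_def[symmetric] measure_triangle cross2_def vector_add_component add_diff_cancel_left'
      by (subst abs_minus_commute) (simp only: mult.commute)
    then show ?thesis unfolding cross2_rot60 using assms by (simp add: v'_def)
  qed
  have "convex hull set (hexagon c v) \<subseteq> (\<Union>k<6. T k)"
  proof
    fix p assume p: "p \<in> convex hull set (hexagon c v)"
    obtain k where "k < 6" "p \<in> T k"
      unfolding T_def using hexagon_triangle[OF v hull_hexagon_le[OF p]] by blast
    then show "p \<in> (\<Union>k<6. T k)" by blast
  qed
  moreover have "compact (convex hull set (hexagon c v))" by (simp add: finite_imp_compact_convex_hull)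
  ultimately have "measure lebesgue (convex hull set (hexagon c v)) \<le> measure lebesgue (\<Union>k<6. T k)"
    using Tm by (intro measure_mono_fmeasurable fmeasurable.finite_UN fmeasurableD[OF lmeasurable_compact]) auto
  also have "\<dots> \<le> (\<Sum>k<6. measure lebesgue (T k))"
    using Tm by (intro measure_UNION_le) (auto simp: fmeasurableD)
  also have "\<dots> = 2 * sqrt 3" unfolding Tk by simp
  finally show ?thesis .
qed

section \<open>Points common to two cells\<close>

lemma in_voronoi_cell_neighbor:
  assumes "z \<in> voronoi_cell X x" "x \<in> X" "dist y z = dist x z"
  shows "z \<in> voronoi_cell X y"
  using assms unfolding voronoi_cell_dist_iff by (metis Diff_iff order_refl singletonD insertCI)

lemma voronoi_cells_equidistant:
  assumes "z \<in> voronoi_cell X x" "z \<in> voronoi_cell X y" "x \<in> X" "y \<in> X"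
  shows "dist x z = dist y z"
  using assms unfolding voronoi_cell_dist_iff by (cases "x = y") (auto intro: antisym)

lemma dist_eq_iff_inner:
  "dist x z = dist (x + w) z \<longleftrightarrow> 2 * ((z - x) \<bullet> w) = w \<bullet> (w::real^2)"
proof -
  have "dist x z = dist (x + w) z \<longleftrightarrow> (dist z x)\<^sup>2 = (dist z (x + w))\<^sup>2"
    by (simp add: dist_commute)
  also have "\<dots> \<longleftrightarrow> (z - x) \<bullet> (z - x) = ((z - x) - w) \<bullet> ((z - x) - w)"
    by (simp add: dist_norm power2_norm_eq_inner diff_diff_eq)
  also have "\<dots> \<longleftrightarrow> 2 * ((z - x) \<bullet> w) = w \<bullet> w"
    unfolding inner_diff_left[of "z - x" w] inner_diff_right[of _ "z - x" w] inner_commute[of w "z - x"] by argo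
  finally show ?thesis .
qed

context
  fixes X :: "(real^2) set" and x v :: "real^2"
  assumes adm: "admissible X" and x: "x \<in> X" and vv: "v \<bullet> v = 4 / 3"
    and hex: "set (hexagon x (v + rot60 v)) \<subseteq> X"
begin

lemma v_nonzero: "v \<noteq> 0"
  using vv by auto

lemma hexagon_offsets: "set (hexagon 0 (v + rot60 v)) \<subseteq> offsets X x"
proof
  fix w assume w: "w \<in> set (hexagon 0 (v + rot60 v))"
  then have "x + w \<in> X" using hex by (auto simp: set_hexagon)
  moreover have "norm w = 2" using w vv by (intro norm_hexagon_0) (simp_all add: add_rot60_inner)
  ultimately show "w \<in> offsets X x" by (auto simp: offsets_iff)
qed

text \<open>No further occupied point can cut the hexagon: each vertex has distance
  \<open>rad\<close> from \<open>x\<close> and from a neighbor, so by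
  \<open>three_points_in_disk\<close> no third occupied point is closer to it. Convexity extends
  this from the vertices to the hull.\<close>

lemma voronoi_cell_hexagon: "voronoi_cell X x = convex hull set (hexagon x v)"
proof
  show "voronoi_cell X x \<subseteq> convex hull set (hexagon x v)"
    using hexagon_offsets by (intro subsetI, subst hull_hexagon_iff[OF v_nonzero]) (simp only: voronoi_cell_iff, blast)
  have "p \<in> voronoi_cell X x" if p: "p \<in> set (hexagon x v)" for p
    unfolding voronoi_cell_dist_iff
  proof (rule ballI, rule ccontr)
    fix y assume y: "y \<in> X - {x}" and far: "\<not> dist x p \<le> dist y p"
    obtain k where k: "p = x + (rot60 ^^ k) v" using p by (auto simp: set_hexagon)
    define v' where "v' = (rot60 ^^ k) v"
    define y1 where "y1 = x + (v' + rot60 v')"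
    have n: "norm v' = rad" "norm (rot60 v') = rad"
      unfolding v'_def norm_eq_sqrt_inner inner_rot60 inner_funpow_rot60 vv
      using real_sqrt_unique[of rad "4 / 3"] by (simp_all add: rad_sq)
    have "y1 \<in> set (hexagon x (v + rot60 v))"
      using funpow_rot60_in_hexagon[of x k "v + rot60 v"]
      by (simp add: y1_def v'_def funpow_rot60_normal)
    then have y1X: "y1 \<in> X" using hex by blast
    have px: "dist p x = rad" "dist p y1 = rad" using n by (simp_all add: k y1_def v'_def dist_norm)
    have py: "dist p y < rad" using far px by (simp add: dist_commute)
    have "(v' + rot60 v') \<bullet> (v' + rot60 v') = 4" unfolding add_rot60_inner using vv by (simp add: v'_def)
    then have "norm (v' + rot60 v') = 2" by (simp only: norm_eq_sqrt_inner real_sqrt_four)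
    then have "dist x y1 = 2"
      by (subst dist_commute) (simp only: y1_def dist_norm add_diff_cancel_left')
    moreover have "y1 \<noteq> y" using px py by auto
    then have "2 \<le> dist y1 y" "2 \<le> dist y x"
      using adm y y1X x unfolding admissible_def pairwise_def by auto
    ultimately have "dist p y = rad" using px py by (intro three_points_in_disk(3)[of p x y1 y]) auto
    then show False using py by simp
  qed
  then show "convex hull set (hexagon x v) \<subseteq> voronoi_cell X x"
    by (intro hull_minimal convex_voronoi_cell) blast
qed

text \<open>Equidistance puts \<open>p\<close> on the line of the side, a + b = 1; the half-planes
  of the two adjacent neighbors, \<open>rot60 w\<close> and \<open>w - rot60 w\<close>, give b <= 1
  and a <= 1.\<close>

lemma hexagon_side:
  "voronoi_cell X x \<inter> voronoi_cell X (x + (rot60 ^^ k) (v + rot60 v))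
    = closed_segment (x + (rot60 ^^ k) v) (x + (rot60 ^^ Suc k) v)"
proof -
  define v' where "v' = (rot60 ^^ k) v"
  define w where "w = v' + rot60 v'"
  have w: "(rot60 ^^ k) (v + rot60 v) = w"
    by (simp add: w_def v'_def funpow_rot60_normal)
  have v'v': "v' \<bullet> v' = 4 / 3" using vv by (simp add: v'_def)
  then have v0: "v' \<noteq> 0" by (cases "v' = 0") auto
  have ww: "w \<bullet> w = 4" using v'v' by (simp add: w_def add_rot60_inner)
  have hexw: "set (hexagon 0 (v + rot60 v)) = set (hexagon 0 w)" by (simp flip: w)
  then have woff: "x + w \<in> X" "w \<in> offsets X x"
    using hexagon_offsets in_set_hexagon(1)[of 0 w] by (auto simp: offsets_iff)
  have verts: "x + v' \<in> voronoi_cell X x" "x + rot60 v' \<in> voronoi_cell X x"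
    using funpow_rot60_in_hexagon[of x k v] funpow_rot60_in_hexagon[of x "Suc k" v]
    unfolding voronoi_cell_hexagon v'_def by (auto intro: hull_inc)
  show ?thesis unfolding w funpow.simps o_def v'_def[symmetric]
  proof (intro equalityI subsetI)
    fix p assume p: "p \<in> closed_segment (x + v') (x + rot60 v')"
    then obtain s where s: "p = (1 - s) *\<^sub>R (x + v') + s *\<^sub>R (x + rot60 v')" "0 \<le> s" "s \<le> 1"
      by (auto simp: in_segment)
    have pV: "p \<in> voronoi_cell X x"
      using p closed_segment_subset[OF verts convex_voronoi_cell] by blast
    have "p - x = (1 - s) *\<^sub>R v' + s *\<^sub>R rot60 v'" unfolding s(1) by (simp add: algebra_simps)
    then have "2 * ((p - x) \<bullet> w) = w \<bullet> w"
      using rot60_side_normal[of v'] v'v' ww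
      by (simp add: inner_add_left flip: w_def)
    then have "p \<in> voronoi_cell X (x + w)"
      using in_voronoi_cell_neighbor[OF pV x, of "x + w"] dist_eq_iff_inner[of x p w] by simp
    then show "p \<in> voronoi_cell X x \<inter> voronoi_cell X (x + w)" using pV by blast
  next
    fix p assume p: "p \<in> voronoi_cell X x \<inter> voronoi_cell X (x + w)"
    then have "dist x p = dist (x + w) p"
      using x woff by (intro voronoi_cells_equidistant[of p X]) auto
    then have pw: "(p - x) \<bullet> w = 2" unfolding dist_eq_iff_inner ww by simp
    obtain a b where ab: "p - x = a *\<^sub>R v' + b *\<^sub>R rot60 v'" using rot60_basis[OF v0] by metis
    have "(p - x) \<bullet> w = 2 * a + 2 * b"
      unfolding ab w_def inner_add_left inner_scaleR_left rot60_side_normal v'v' by simp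
    then have sum: "a + b = 1" using pw by simp
    have le: "2 * ((p - x) \<bullet> u) \<le> u \<bullet> u" if "u \<in> set (hexagon 0 w)" for u
    proof -
      have "u \<in> offsets X x" using that hexagon_offsets unfolding hexw by blast
      moreover have "p \<in> voronoi_cell X x" using p by blast
      ultimately show ?thesis unfolding voronoi_cell_iff by blast
    qed
    have "rot60 w \<in> set (hexagon 0 w)" by (simp add: hexagon_def)
    then have "2 * ((p - x) \<bullet> rot60 w) \<le> 4" using le[of "rot60 w"] ww by simp
    moreover have "(p - x) \<bullet> rot60 w = 2 * b"
      unfolding ab w_def rot60_add rot60_rot60 inner_add_left inner_add_right inner_diff_right
        inner_scaleR_left inner_rot60 v'v' by (simp add: algebra_simps)
    ultimately have b: "b \<le> 1" by simp
    have "w - rot60 w \<in> set (hexagon 0 w)" by (simp add: hexagon_def)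
    then have "2 * ((p - x) \<bullet> (w - rot60 w)) \<le> 4"
      using le[of "w - rot60 w"] ww by (simp add: inner_simps)
    moreover have "(p - x) \<bullet> (w - rot60 w) = 2 * a"
      unfolding ab w_def rot60_add rot60_rot60 inner_add_left inner_add_right inner_diff_right
        inner_scaleR_left inner_rot60 v'v' by (simp add: algebra_simps)
    ultimately have a: "a \<le> 1" by simp
    have ab1: "a = 1 - b" using sum by simp
    have "p = x + (a *\<^sub>R v' + b *\<^sub>R rot60 v')" by (simp flip: ab)
    also have "\<dots> = (1 - b) *\<^sub>R (x + v') + b *\<^sub>R (x + rot60 v')"
      unfolding ab1 by (simp add: algebra_simps)
    finally have "p = (1 - b) *\<^sub>R (x + v') + b *\<^sub>R (x + rot60 v')" .
    then show "p \<in> closed_segment (x + v') (x + rot60 v')"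
      unfolding in_segment using a b sum by (intro exI[of _ b]) auto
  qed
qed

text \<open>Place the offset \<open>u\<close> of a neighbor in the cone spanned by two adjacent
  hexagon offsets. On a boundary ray, admissibility and contact with the cell force \<open>u\<close>
  to be the hexagon offset itself; inside the cone, the cells can meet in a vertex only, which is
  not enough for a neighbor.\<close>

lemma neighbors_hexagon: "{y. neighbor X x y} = set (hexagon x (v + rot60 v))"
proof (intro equalityI subsetI)
  fix y assume "y \<in> set (hexagon x (v + rot60 v))"
  then obtain k where y: "y = x + (rot60 ^^ k) (v + rot60 v)" by (auto simp: set_hexagon)
  define v' where "v' = (rot60 ^^ k) v"
  have "v' \<bullet> v' = 4 / 3" using vv by (simp add: v'_def)
  then have "v' \<noteq> 0" by (cases "v' = 0") auto
  then have "(v' - rot60 v') \<bullet> (v' - rot60 v') \<noteq> 0"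
    unfolding inner_diff_left inner_diff_right inner_rot60 by simp
  then have "v' \<noteq> rot60 v'" by auto
  then have ne: "x + v' \<noteq> x + rot60 v'" by simp
  have "y \<in> X" "y \<noteq> x"
    using hexagon_offsets funpow_rot60_in_hexagon[of 0 k "v + rot60 v"] unfolding y by (auto simp: offsets_iff)
  moreover have "voronoi_cell X x \<inter> voronoi_cell X y = closed_segment (x + v') (x + rot60 v')"
    unfolding y hexagon_side by (simp add: v'_def)
  ultimately show "y \<in> {y. neighbor X x y}"
    unfolding neighbor_def using ne by blast
next
  fix y assume "y \<in> {y. neighbor X x y}"
  then obtain p q where y: "y \<in> X" "y \<noteq> x" and pq: "p \<noteq> q"
    "p \<in> voronoi_cell X x" "p \<in> voronoi_cell X y" "q \<in> voronoi_cell X x" "q \<in> voronoi_cell X y"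
    unfolding neighbor_def by blast
  define u where "u = y - x"
  have u: "u \<in> offsets X x" and yu: "y = x + u" using y by (auto simp: offsets_iff u_def)
  have pu: "2 * ((p - x) \<bullet> u) = u \<bullet> u" and qu: "2 * ((q - x) \<bullet> u) = u \<bullet> u"
    using voronoi_cells_equidistant[OF _ _ x y(1)] pq dist_eq_iff_inner[of x _ u] unfolding yu by blast+
  have w0: "v + rot60 v \<noteq> 0" using add_rot60_inner[of v] vv by auto
  obtain k a b where ab: "0 \<le> a" "0 \<le> b"
    and uab: "u = a *\<^sub>R (rot60 ^^ k) (v + rot60 v) + b *\<^sub>R rot60 ((rot60 ^^ k) (v + rot60 v))"
    using hexagon_sector[OF w0] by metis
  define v' where "v' = (rot60 ^^ k) v"
  define w where "w = v' + rot60 v'"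
  have w: "(rot60 ^^ k) (v + rot60 v) = w" by (simp add: w_def v'_def funpow_rot60_normal)
  have v'v': "v' \<bullet> v' = 4 / 3" using vv by (simp add: v'_def)
  then have ww: "w \<bullet> w = 4" by (simp add: w_def add_rot60_inner)
  then have wne: "w \<noteq> 0" by (cases "w = 0") auto
  have in_hex: "x + w \<in> set (hexagon x (v + rot60 v))" "x + rot60 w \<in> set (hexagon x (v + rot60 v))"
    using funpow_rot60_in_hexagon[of x k "v + rot60 v"] funpow_rot60_in_hexagon[of x "Suc k" "v + rot60 v"] w
    by simp_all
  then have off: "w \<in> offsets X x" "rot60 w \<in> offsets X x"
    using hexagon_offsets funpow_rot60_in_hexagon[of 0 k "v + rot60 v"]
      funpow_rot60_in_hexagon[of 0 "Suc k" "v + rot60 v"] w by auto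
  have le: "(z - x) \<bullet> w \<le> 2" "(z - x) \<bullet> rot60 w \<le> 2" if "z \<in> voronoi_cell X x" for z
    using that off ww unfolding voronoi_cell_iff by fastforce+
  have u: "u = a *\<^sub>R w + b *\<^sub>R rot60 w" and uu: "u \<bullet> u = 4 * (a\<^sup>2 + a * b + b\<^sup>2)" and u4: "4 \<le> u \<bullet> u"
    using uab ww offsets_inner[OF adm x u] unfolding w
    by (simp_all add: inner_simps power2_eq_square algebra_simps)
  have zu: "(z - x) \<bullet> u = a * ((z - x) \<bullet> w) + b * ((z - x) \<bullet> rot60 w)" for z
    unfolding u by (simp add: inner_simps)
  have za: "a * ((z - x) \<bullet> w) \<le> a * 2" "b * ((z - x) \<bullet> rot60 w) \<le> b * 2" if "z \<in> voronoi_cell X x" for z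
    using le[OF that] ab by (simp_all add: mult_left_mono)
  consider "a = 0" | "b = 0" | "0 < a" "0 < b" using ab by linarith
  then show "y \<in> set (hexagon x (v + rot60 v))"
  proof cases
    case 1
    have "(p - x) \<bullet> u = b * ((p - x) \<bullet> rot60 w)" "u \<bullet> u = 4 * (b * b)"
      using zu[of p] uu 1 by (simp_all add: power2_eq_square)
    then have "b * b \<le> b * 1" using za(2)[OF pq(2)] pu by linarith
    moreover have "1 \<le> b\<^sup>2" using u4 uu 1 by simp
    then have "1 \<le> b" using ab by (simp add: abs_le_square_iff[of 1 b, simplified, symmetric])
    ultimately have "b = 1" by (simp add: mult_le_cancel_left_pos)
    then show ?thesis using in_hex 1 u yu by simp
  next
    case 2
    have "(p - x) \<bullet> u = a * ((p - x) \<bullet> w)" "u \<bullet> u = 4 * (a * a)"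
      using zu[of p] uu 2 by (simp_all add: power2_eq_square)
    then have "a * a \<le> a * 1" using za(1)[OF pq(2)] pu by linarith
    moreover have "1 \<le> a\<^sup>2" using u4 uu 2 by simp
    then have "1 \<le> a" using ab by (simp add: abs_le_square_iff[of 1 a, simplified, symmetric])
    ultimately have "a = 1" by (simp add: mult_le_cancel_left_pos)
    then show ?thesis using in_hex 2 u yu by simp
  next
    case 3
    \<comment> \<open>The vertex shared by the sides of \<open>w\<close> and \<open>rot60 w\<close>.
      It maximizes the inner product with \<open>u\<close> over the cell, and for a, b > 0 every
      maximizer satisfies both side equations, so \<open>p\<close> and \<open>q\<close>
      coincide.\<close>
    define r where "r = rot60 v'"
    have rw: "r \<bullet> w = 2" "r \<bullet> rot60 w = 2"
      unfolding w_def r_def rot60_add rot60_rot60 inner_add_right inner_diff_right inner_rot60 v'v'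
      by simp_all
    have "x + r \<in> voronoi_cell X x"
      using funpow_rot60_in_hexagon[of x "Suc k" v]
      unfolding voronoi_cell_hexagon r_def v'_def by (auto intro: hull_inc)
    then have "2 * (r \<bullet> u) \<le> u \<bullet> u"
      using \<open>u \<in> offsets X x\<close> unfolding voronoi_cell_iff by fastforce
    then have ur: "2 * (a * 2 + b * 2) \<le> u \<bullet> u" unfolding u inner_add_right inner_scaleR_right rw .
    have eq: "(z - x) \<bullet> w = 2 \<and> (z - x) \<bullet> rot60 w = 2"
      if "z \<in> voronoi_cell X x" "2 * ((z - x) \<bullet> u) = u \<bullet> u" for z
    proof -
      have "a * 2 \<le> a * ((z - x) \<bullet> w)" "b * 2 \<le> b * ((z - x) \<bullet> rot60 w)"
        using za[OF that(1)] that(2) ur unfolding zu by argo+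
      then have "2 \<le> (z - x) \<bullet> w" "2 \<le> (z - x) \<bullet> rot60 w" using 3 by simp_all
      then show ?thesis using le[OF that(1)] by (intro conjI antisym)
    qed
    have 0: "(p - q) \<bullet> w = 0" "(p - q) \<bullet> rot60 w = 0"
      using eq[OF pq(2) pu] eq[OF pq(4) qu] by (simp_all add: inner_simps)
    obtain c d where "p - q = c *\<^sub>R w + d *\<^sub>R rot60 w" using rot60_basis[OF wne] by metis
    then have "(p - q) \<bullet> (p - q) = c * ((p - q) \<bullet> w) + d * ((p - q) \<bullet> rot60 w)"
      by (metis inner_add_right inner_scaleR_right)
    then have "p = q" by (simp add: 0)
    then show ?thesis using pq(1) by blast
  qed
qed

lemma neighbor_polygon_hexagon: "neighbor_polygon X x (hexagon x (v + rot60 v))"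
  unfolding neighbor_polygon_def
proof (intro conjI exI[of _ "hexagon x v"] allI impI)
  show "set (hexagon x (v + rot60 v)) = {y. neighbor X x y}" by (simp add: neighbors_hexagon)
  show "clockwise_convex_polygon (hexagon x v)" using v_nonzero by (rule clockwise_hexagon)
  show "voronoi_cell X x = convex hull set (hexagon x v)" by (rule voronoi_cell_hexagon)
  fix i assume "i < length (hexagon x v)"
  then have i: "i < 6" by simp
  show "voronoi_cell X x \<inter> voronoi_cell X (hexagon x (v + rot60 v) ! i)
      = closed_segment (hexagon x v ! i) (cnth (hexagon x v) (Suc i))"
    unfolding hexagon_nth[OF i] hexagon_cnth_Suc[OF i] by (rule hexagon_side)
qed simp

end

subsection \<open>The two regular hexagons\<close>

lemma sum_lessThan_6:
  fixes f :: "nat \<Rightarrow> 'a :: comm_monoid_add"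
  shows "(\<Sum>i<6. f i) = f 0 + f 1 + f 2 + f 3 + f 4 + f 5"
  by (simp add: eval_nat_numeral)

context
  fixes X :: "(real^2) set" and x :: "real^2"
  assumes adm: "admissible X" and x: "x \<in> X"
begin

lemma regular_hexagon_region_of_hexagon:
  assumes w: "w \<bullet> w = 4" and hex: "set (hexagon x w) \<subseteq> X"
  shows "regular_hexagon_region (2 / sqrt 3) (voronoi_cell X x)"
proof -
  obtain v where v: "w = v + rot60 v" "v \<bullet> v = 4 / 3"
    using hexagon_vertex_of_normal[of w] w by metis
  have "norm v = 2 / sqrt 3"
    using real_sqrt_unique[of rad "4 / 3"] by (simp add: norm_eq_sqrt_inner v(2) rad_sq flip: rad_def)
  then have "regular_polygon 6 (2 / sqrt 3) (hexagon x v)" by (rule regular_hexagon) simp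
  then show ?thesis
    unfolding regular_hexagon_region_def using voronoi_cell_hexagon[OF adm x v(2)] hex v(1) by blast
qed

text \<open>If the cell lies in the half-plane of a vector \<open>w\<close> of length \<open>2\<close>, the points just beyond
  \<open>x + w / 2\<close> are closer to some occupied point, which must be arbitrarily close to \<open>x + w\<close>.\<close>

lemma offset_of_side:
  assumes w: "w \<bullet> w = 4" and le: "\<And>z. z \<in> voronoi_cell X x \<Longrightarrow> (z - x) \<bullet> w \<le> 2"
  shows "x + w \<in> X"
proof -
  have near: "\<exists>u\<in>offsets X x. (u - w) \<bullet> (u - w) < 8 * t" if t: "0 < t" "t \<le> 1" for t
  proof -
    define z where "z = x + ((1 + t) / 2) *\<^sub>R w"
    have "(z - x) \<bullet> w = 2 * (1 + t)" by (simp add: z_def w)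
    then have "z \<notin> voronoi_cell X x" using le[of z] t by auto
    then obtain u where u: "u \<in> offsets X x" "\<not> 2 * ((z - x) \<bullet> u) \<le> u \<bullet> u"
      unfolding voronoi_cell_iff by blast
    have "u \<bullet> u < (1 + t) * (u \<bullet> w)" using u(2) by (simp add: z_def inner_commute)
    moreover have "4 * (1 - t) \<le> (u \<bullet> u) * (1 - t)" using offsets_inner[OF adm x u(1)] t by (intro mult_right_mono) auto
    ultimately have "(1 + t) * ((u - w) \<bullet> (u - w)) < 8 * t"
      by (simp add: inner_diff_left inner_diff_right inner_commute[of w u] w algebra_simps)
    moreover have "1 * ((u - w) \<bullet> (u - w)) \<le> (1 + t) * ((u - w) \<bullet> (u - w))"
      using t by (intro mult_right_mono) auto
    ultimately have "(u - w) \<bullet> (u - w) < 8 * t" by linarith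
    then show ?thesis using u(1) by blast
  qed
  obtain u where u: "u \<in> offsets X x" "(u - w) \<bullet> (u - w) < 1" using near[of "1 / 8"] by auto
  \<comment> \<open>Otherwise a smaller \<open>t\<close> gives a second offset even closer to
    \<open>w\<close>; two offsets within distance 1 of \<open>w\<close> contradict
    admissibility.\<close>
  have "u = w"
  proof (rule ccontr)
    assume "u \<noteq> w"
    then have pos: "0 < (u - w) \<bullet> (u - w)" by simp
    obtain u' where u': "u' \<in> offsets X x" "(u' - w) \<bullet> (u' - w) < (u - w) \<bullet> (u - w)"
      using near[of "((u - w) \<bullet> (u - w)) / 8"] pos u(2) by auto
    then have "u' \<noteq> u" by auto
    then have "2 \<le> dist u u'" using offsets_pairwise[OF adm x] u(1) u'(1) by (auto simp: pairwise_def)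
    moreover have "norm (u - w) < 1" "norm (u' - w) < 1"
      using u u' by (simp_all add: norm_eq_sqrt_inner)
    then have "dist u u' < 2" using dist_triangle_half_l[of u w 2 u'] by (simp add: dist_norm)
    ultimately show False by simp
  qed
  then show ?thesis using u(1) by (simp add: offsets_iff)
qed

text \<open>The center \<open>c\<close> of the region is a priori unrelated to \<open>x\<close>. The
  unit disk about \<open>x\<close> lies in the cell, whose inradius is 1, so \<open>c = x\<close>;
  then each side yields an occupied point by \<open>offset_of_side\<close>.\<close>

lemma neighbor_polygon_of_hexagon_region:
  assumes "regular_hexagon_region (2 / sqrt 3) (voronoi_cell X x)"
  shows "\<exists>ns. neighbor_polygon X x ns \<and> regular_polygon 6 2 ns"
proof -
  obtain ps where reg: "regular_polygon 6 (2 / sqrt 3) ps" and V: "voronoi_cell X x = convex hull set ps"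
    using assms unfolding regular_hexagon_region_def by blast
  then obtain c v where nv: "norm v = 2 / sqrt 3" and ps: "set ps = set (hexagon c v)"
    using regular_polygon_6_hexagon[OF reg] by (metis divide_pos_pos real_sqrt_gt_0_iff zero_less_numeral)
  have vv: "v \<bullet> v = 4 / 3" using nv by (simp add: power_divide flip: power2_norm_eq_inner)
  define w where "w = v + rot60 v"
  have ww: "w \<bullet> w = 4" unfolding w_def add_rot60_inner vv by simp
  have le: "(z - c) \<bullet> u \<le> 2" if "z \<in> voronoi_cell X x" "u \<in> set (hexagon 0 w)" for z u
  proof -
    have "norm u = 2" using norm_hexagon_0[OF ww that(2)] .
    then have "u \<bullet> u = 4" by (simp flip: power2_norm_eq_inner)
    then show ?thesis using hull_hexagon_le[of z c v u] that unfolding V ps w_def by simp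
  qed
  \<comment> \<open>The extreme point \<open>x + u / 2\<close> of the unit disk lies in the cell.
    Opposite directions \<open>u\<close> turn the resulting inequalities into equations.\<close>
  have center_le: "(x - c) \<bullet> u \<le> 0" if u: "u \<in> set (hexagon 0 w)" for u
  proof -
    have nu: "norm u = 2" using norm_hexagon_0[OF ww u] .
    then have uu: "u \<bullet> u = 4" by (simp flip: power2_norm_eq_inner)
    have "u \<bullet> y \<le> y \<bullet> y" if "y \<in> offsets X x" for y
    proof -
      have "u \<bullet> y \<le> 2 * norm y" using norm_cauchy_schwarz[of u y] nu by simp
      also have "\<dots> \<le> norm y * norm y" using offsets_norm[OF adm x that] by (intro mult_right_mono) auto
      finally show ?thesis by (simp add: power2_norm_eq_inner flip: power2_eq_square)
    qed
    then have "x + (1 / 2) *\<^sub>R u \<in> voronoi_cell X x" by (simp add: voronoi_cell_iff)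
    then have "(x + (1 / 2) *\<^sub>R u - c) \<bullet> u \<le> 2" using le u by blast
    then show ?thesis by (simp add: inner_add_left inner_diff_left uu)
  qed
  have "w \<in> set (hexagon 0 w)" "- w \<in> set (hexagon 0 w)" "rot60 w \<in> set (hexagon 0 w)"
    "- rot60 w \<in> set (hexagon 0 w)" by (simp_all add: hexagon_def)
  from this[THEN center_le] have perp: "(x - c) \<bullet> w = 0" "(x - c) \<bullet> rot60 w = 0" by simp_all
  have "w \<noteq> 0" using ww by auto
  then obtain a b where "x - c = a *\<^sub>R w + b *\<^sub>R rot60 w" using rot60_basis by metis
  then have "(x - c) \<bullet> (x - c) = a * ((x - c) \<bullet> w) + b * ((x - c) \<bullet> rot60 w)"
    by (metis inner_add_right inner_scaleR_right)
  then have c: "c = x" by (simp add: perp)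
  have "set (hexagon x w) \<subseteq> X"
  proof
    fix y assume "y \<in> set (hexagon x w)"
    then obtain k where y: "y = x + (rot60 ^^ k) w" by (auto simp: set_hexagon)
    show "y \<in> X" unfolding y
      using le funpow_rot60_in_hexagon[of 0 k w] ww unfolding c by (intro offset_of_side) auto
  qed
  then have "neighbor_polygon X x (hexagon x w)"
    unfolding w_def by (rule neighbor_polygon_hexagon[OF adm x vv])
  moreover have "norm w = 2" by (simp add: norm_eq_sqrt_inner ww)
  then have "regular_polygon 6 2 (hexagon x w)" by (rule regular_hexagon) simp
  ultimately show ?thesis by blast
qed

text \<open>An edge of the cell, turned outward by a right angle, is a positive multiple of the offset of
  the neighbor across it. As the edges sum to zero, \<open>x\<close> is a convex combination of the neighbors.\<close>

lemma in_hull_neighbors: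
  assumes "neighbor_polygon X x ns" "length ns = 6"
  shows "x \<in> convex hull set ns"
proof -
  obtain vs where cw: "clockwise_convex_polygon vs" and V: "voronoi_cell X x = convex hull set vs"
    and len: "length vs = 6"
    and side: "\<And>i. i < 6 \<Longrightarrow> voronoi_cell X x \<inter> voronoi_cell X (ns ! i) = closed_segment (vs ! i) (cnth vs (Suc i))"
    using assms unfolding neighbor_polygon_def by metis
  define J :: "real^2 \<Rightarrow> real^2" where "J z = vector [- z$2, z$1]" for z
  define e where "e i = cnth vs (Suc i) - vs ! i" for i
  have Jcross: "J a \<bullet> b = cross2 a b" for a b by (simp add: J_def inner_2 cross2_def)
  have xV: "x \<in> voronoi_cell X x" by (simp add: voronoi_cell_dist_iff)
  have "\<exists>\<mu>>0. J (e i) = \<mu> *\<^sub>R (ns ! i - x)" if i: "i < 6" for i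
  proof -
    define y where "y = ns ! i - x"
    have "ns ! i \<in> set ns" using i assms(2) by simp
    then have "neighbor X x (ns ! i)" using assms(1) unfolding neighbor_polygon_def by blast
    then have nX: "ns ! i \<in> X" "ns ! i \<noteq> x" unfolding neighbor_def by auto
    then have yy: "0 < y \<bullet> y" by (simp add: y_def)
    have eq: "2 * ((p - x) \<bullet> y) = y \<bullet> y" if "p \<in> closed_segment (vs ! i) (cnth vs (Suc i))" for p
      using voronoi_cells_equidistant[of p X x "ns ! i"] that side[OF i] x nX dist_eq_iff_inner[of x p y]
      by (auto simp: y_def)
    have 1: "2 * ((vs ! i - x) \<bullet> y) = y \<bullet> y" by (rule eq) simp
    have 2: "2 * ((cnth vs (Suc i) - x) \<bullet> y) = y \<bullet> y" by (rule eq) simp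
    have perp: "e i \<bullet> y = 0"
      using 1 2 unfolding e_def by (simp add: inner_diff_left)
    \<comment> \<open>The clockwise order puts all vertices, hence the whole cell and
      \<open>x\<close>, on the inner side of the edge; this determines the sign of
      \<open>\<mu>\<close>.\<close>
    have "J (e i) \<bullet> (x - vs ! i) \<le> 0"
    proof -
      have "J (e i) \<bullet> (p - vs ! i) \<le> 0" if p: "p \<in> set vs" for p
      proof -
        obtain j where j: "j < 6" "p = vs ! j" using p len by (metis in_set_conv_nth)
        consider "j = i" | "j = Suc i mod 6" | "j \<noteq> i" "j \<noteq> Suc i mod 6" by blast
        then show ?thesis
        proof cases
          case 3
          then show ?thesis using cw i j len
            unfolding clockwise_convex_polygon_def Jcross e_def by (metis less_imp_le)
        qed (simp_all add: Jcross e_def j len cross2_def)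
      qed
      then have "set vs \<subseteq> {p. J (e i) \<bullet> p \<le> J (e i) \<bullet> vs ! i}"
        by (auto simp: inner_diff_right)
      then have "convex hull set vs \<subseteq> {p. J (e i) \<bullet> p \<le> J (e i) \<bullet> vs ! i}"
        by (rule hull_minimal) (rule convex_halfspace_le)
      then show ?thesis using xV unfolding V by (auto simp: inner_diff_right)
    qed
    then have nonneg: "0 \<le> J (e i) \<bullet> (vs ! i - x)" by (simp add: inner_diff_right)
    have rot: "(y \<bullet> y) *\<^sub>R J (e i) = (J (e i) \<bullet> y) *\<^sub>R y"
    proof -
      have "(y \<bullet> y) *\<^sub>R J (e i) = (J (e i) \<bullet> y) *\<^sub>R y + (e i \<bullet> y) *\<^sub>R J y"
        by (simp add: vec_eq_2 J_def inner_2 algebra_simps)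
      then show ?thesis by (simp add: perp)
    qed
    define \<mu> where "\<mu> = (J (e i) \<bullet> y) / (y \<bullet> y)"
    have Je: "J (e i) = \<mu> *\<^sub>R y"
    proof -
      have "J (e i) = (1 / (y \<bullet> y)) *\<^sub>R ((y \<bullet> y) *\<^sub>R J (e i))" using yy by simp
      then show ?thesis unfolding rot by (simp add: \<mu>_def)
    qed
    have "J (e i) \<bullet> (vs ! i - x) = \<mu> * ((y \<bullet> y) / 2)"
      unfolding Je using 1 by (simp add: inner_commute)
    then have "0 \<le> \<mu> * ((y \<bullet> y) / 2)" using nonneg by simp
    then have "\<not> \<mu> < 0" using yy mult_neg_pos[of \<mu> "(y \<bullet> y) / 2"] by fastforce
    then have "0 \<le> \<mu>" by simp
    \<comment> \<open>A zero edge would annihilate the cross product with the vertex two places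
      further on, which strict convexity makes negative.\<close>
    moreover have "\<mu> \<noteq> 0"
    proof
      assume "\<mu> = 0"
      then have "e i = 0" using Je by (simp add: J_def vec_eq_2)
      moreover define j where "j = (i + 2) mod 6"
      have "j < 6" "j \<noteq> i" "j \<noteq> Suc i mod 6"
        using i unfolding less_6 j_def by (elim disjE; simp)+
      then have "cross2 (e i) (vs ! j - vs ! i) < 0"
        using cw i len unfolding clockwise_convex_polygon_def e_def by metis
      ultimately show False by (simp add: cross2_def)
    qed
    ultimately show ?thesis using Je by (intro exI[of _ \<mu>]) (auto simp: y_def)
  qed
  then obtain \<mu> where mu: "\<And>i. i < 6 \<Longrightarrow> 0 < \<mu> i" "\<And>i. i < 6 \<Longrightarrow> J (e i) = \<mu> i *\<^sub>R (ns ! i - x)"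
    by metis
  have "e 1 = vs ! 2 - vs ! 1" by (simp add: e_def len flip: numeral_2_eq_2)
  then have "(\<Sum>i<6. e i) = 0" unfolding sum_lessThan_6 by (simp add: e_def[of 0] e_def[of 2] e_def[of 3] e_def[of 4] e_def[of 5] len)
  then have "J (\<Sum>i<6. e i) = 0" by (simp add: J_def vec_eq_2)
  moreover have "J (a + b) = J a + J b" "J 0 = 0" for a b by (simp_all add: J_def vec_eq_2)
  then have "J (\<Sum>i<6. e i) = (\<Sum>i<6. J (e i))" unfolding sum_lessThan_6 by simp
  ultimately have "(\<Sum>i<6. \<mu> i *\<^sub>R (ns ! i - x)) = 0" using mu(2) by simp
  then have sum0: "(\<Sum>i<6. \<mu> i *\<^sub>R ns ! i) = (\<Sum>i<6. \<mu> i) *\<^sub>R x"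
    by (simp add: scaleR_diff_right sum_subtractf scaleR_sum_left)
  define M where "M = (\<Sum>i<6. \<mu> i)"
  have M: "0 < M" unfolding M_def sum_lessThan_6 using mu(1) by (simp add: add_pos_pos)
  have "(\<Sum>i<6. \<mu> i / M) = 1" using M by (simp add: M_def flip: sum_divide_distrib)
  then have "(\<Sum>i<6. (\<mu> i / M) *\<^sub>R ns ! i) \<in> convex hull set ns"
    using mu(1) M assms(2) by (intro convex_sum convex_convex_hull) (auto simp: less_imp_le hull_inc)
  also have "(\<Sum>i<6. (\<mu> i / M) *\<^sub>R ns ! i) = (1 / M) *\<^sub>R (\<Sum>i<6. \<mu> i *\<^sub>R ns ! i)"
    by (simp add: scaleR_sum_right)
  also have "\<dots> = x" unfolding sum0 M_def[symmetric] using M by simp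
  finally show ?thesis .
qed

text \<open>As a point of the hull, \<open>x\<close> lies in one of the six equilateral triangles of
  side 2 at the center \<open>c\<close>. Its distance to the two outer vertices is at least 2, and
  in such a triangle only the apex \<open>c\<close> satisfies this.\<close>

lemma hexagon_region_of_neighbor_polygon:
  assumes "neighbor_polygon X x ns" "regular_polygon 6 2 ns"
  shows "regular_hexagon_region (2 / sqrt 3) (voronoi_cell X x)"
proof -
  have "length ns = 6" using assms(2) by (simp add: regular_polygon_def)
  then have hull: "x \<in> convex hull set ns" using in_hull_neighbors assms(1) by blast
  obtain c w where nw: "norm w = 2" and ns: "set ns = set (hexagon c w)"
    using regular_polygon_6_hexagon[OF assms(2)] by (metis zero_less_numeral)
  have ww: "w \<bullet> w = 4" using nw by (simp flip: power2_norm_eq_inner)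
  have off: "y - x \<in> offsets X x" if "y \<in> set (hexagon c w)" for y
    using that assms(1) unfolding ns[symmetric] neighbor_polygon_def neighbor_def offsets_iff by auto
  have w0: "w \<noteq> 0" using ww by auto
  obtain k a b where k: "k < 6" and ab: "0 \<le> a" "0 \<le> b"
    and "x - c = a *\<^sub>R (rot60 ^^ k) w + b *\<^sub>R rot60 ((rot60 ^^ k) w)"
    using hexagon_sector[OF w0] by metis
  then have xc: "x - c = a *\<^sub>R u + b *\<^sub>R rot60 u" if "u = (rot60 ^^ k) w" for u using that by simp
  define u where "u = (rot60 ^^ k) w"
  note xc = xc[OF u_def]
  have uu: "u \<bullet> u = 4" using ww by (simp add: u_def)
  have "u + rot60 u \<in> set (hexagon 0 (w + rot60 w))"
    using funpow_rot60_in_hexagon[of 0 k "w + rot60 w"] by (simp add: u_def funpow_rot60_normal)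
  then have "2 * ((x - c) \<bullet> (u + rot60 u)) \<le> (u + rot60 u) \<bullet> (u + rot60 u)"
    using hull_hexagon_le hull unfolding ns by blast
  then have ab1: "a + b \<le> 1"
    unfolding xc inner_add_left[of "a *\<^sub>R u"] inner_scaleR_left rot60_side_normal add_rot60_inner uu by simp
  have d: "4 \<le> (c + u - x) \<bullet> (c + u - x)" "4 \<le> (c + rot60 u - x) \<bullet> (c + rot60 u - x)"
    using offsets_inner[OF adm x off] funpow_rot60_in_hexagon[of c k w] funpow_rot60_in_hexagon[of c "Suc k" w]
    by (simp_all add: u_def)
  have diffs: "c + u - x = (1 - a) *\<^sub>R u - b *\<^sub>R rot60 u" "c + rot60 u - x = (1 - b) *\<^sub>R rot60 u - a *\<^sub>R u"
    using xc by (simp_all add: algebra_simps eq_diff_eq diff_eq_eq)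
  have "(c + u - x) \<bullet> (c + u - x) = 4 * ((1 - a)\<^sup>2 - (1 - a) * b + b\<^sup>2)"
    "(c + rot60 u - x) \<bullet> (c + rot60 u - x) = 4 * ((1 - b)\<^sup>2 - (1 - b) * a + a\<^sup>2)"
    unfolding diffs inner_diff_left inner_diff_right inner_scaleR_left inner_scaleR_right inner_rot60 uu
    by (simp_all add: power2_eq_square algebra_simps)
  \<comment> \<open>The sum of both distance bounds. Combined with (a + b)^2 <= a + b and a b >= 0
    it leaves a + b <= 0.\<close>
  with d have "2 * (a\<^sup>2 + a * b + b\<^sup>2) \<ge> 3 * (a + b)"
    by (simp add: power2_eq_square algebra_simps)
  moreover have "(a + b) * (a + b) \<le> 1 * (a + b)" using ab ab1 by (intro mult_right_mono) auto
  then have "a\<^sup>2 + 2 * (a * b) + b\<^sup>2 \<le> a + b" by (simp add: power2_eq_square algebra_simps)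
  moreover have "0 \<le> a * b" using ab by simp
  moreover have "s \<le> 0" if "3 * s \<le> 2 * (A + P + B)" "A + 2 * P + B \<le> s" "0 \<le> P" for s A B P :: real
    using that by (simp only: distrib_left)
  ultimately have "a + b \<le> 0" by blast
  then have "a = 0" "b = 0" using ab by auto
  then have c: "c = x" using xc by simp
  have "set (hexagon x w) \<subseteq> X" using off unfolding c offsets_iff by auto
  then show ?thesis using regular_hexagon_region_of_hexagon[OF ww] by blast
qed

end

theorem mainTheorem1:
  shows "(\<exists>(X :: (real^2) set) x. admissible X \<and> x \<in> X \<and>
            emeasure lebesgue (voronoi_cell X x) = ennreal (2 * sqrt 3))
       \<and> (\<forall>(X :: (real^2) set) x. admissible X \<and> x \<in> X \<longrightarrow>
            ennreal (2 * sqrt 3) \<le> emeasure lebesgue (voronoi_cell X x)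
          \<and> (emeasure lebesgue (voronoi_cell X x) = ennreal (2 * sqrt 3) \<longrightarrow>
               regular_hexagon_region (2 / sqrt 3) (voronoi_cell X x))
          \<and> (regular_hexagon_region (2 / sqrt 3) (voronoi_cell X x) \<longleftrightarrow>
               (\<exists>ns. neighbor_polygon X x ns \<and> regular_polygon 6 2 ns)))"
proof (intro conjI allI impI)
  define w :: "real^2" where "w = vector [2, 0]"
  have ww: "w \<bullet> w = 4" by (simp add: w_def inner_2)
  obtain v where v: "w = v + rot60 v" "v \<bullet> v = 4 / 3"
    using hexagon_vertex_of_normal[of w] ww by metis
  \<comment> \<open>Seven points in place of the full triangular lattice: the six around the origin
    already determine its cell.\<close>
  define X where "X = insert 0 (set (hexagon 0 w))"
  have adm: "admissible X"
    using norm_hexagon_0[OF ww] pairwise_hexagon[OF ww]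
    unfolding admissible_def X_def pairwise_insert by (auto simp: pairwise_def)
  have 0: "0 \<in> X" by (simp add: X_def)
  have V: "voronoi_cell X 0 = convex hull set (hexagon 0 v)"
    using v by (intro voronoi_cell_hexagon[OF adm 0]) (auto simp: X_def)
  have "compact (convex hull set (hexagon 0 v))" by (simp add: finite_imp_compact_convex_hull)
  then have "emeasure lebesgue (voronoi_cell X 0) = ennreal (measure lebesgue (voronoi_cell X 0))"
    unfolding V by (intro emeasure_eq_measure2 lmeasurable_compact)
  also have "\<dots> \<le> ennreal (2 * sqrt 3)"
    unfolding V using measure_hull_hexagon[OF v(2)] by (rule ennreal_leI)
  finally have "emeasure lebesgue (voronoi_cell X 0) = ennreal (2 * sqrt 3)"
    using emeasure_voronoi_cell_ge[OF adm 0] by (rule antisym)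
  then show "\<exists>(X :: (real^2) set) x. admissible X \<and> x \<in> X \<and>
      emeasure lebesgue (voronoi_cell X x) = ennreal (2 * sqrt 3)"
    using adm 0 by blast
next
  fix X :: "(real^2) set" and x assume "admissible X \<and> x \<in> X"
  then have adm: "admissible X" and x: "x \<in> X" by auto
  show "ennreal (2 * sqrt 3) \<le> emeasure lebesgue (voronoi_cell X x)"
    by (rule emeasure_voronoi_cell_ge[OF adm x])
  show "regular_hexagon_region (2 / sqrt 3) (voronoi_cell X x) \<longleftrightarrow>
      (\<exists>ns. neighbor_polygon X x ns \<and> regular_polygon 6 2 ns)"
    using neighbor_polygon_of_hexagon_region[OF adm x] hexagon_region_of_neighbor_polygon[OF adm x] by blast
  assume "emeasure lebesgue (voronoi_cell X x) = ennreal (2 * sqrt 3)"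
  then show "regular_hexagon_region (2 / sqrt 3) (voronoi_cell X x)"
    using minimal_cell_hexagon[OF adm x] regular_hexagon_region_of_hexagon[OF adm x] by metis
qed

end
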